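(* Let $V=\mathbb Q^d$ and let $k,n$ be positive integers. Every $GL(V)$-equivariant polynomial map $H:End(V)^k\to End(V)^{\otimes n}$ is a linear combination of maps of the form $$(x_1,\dots,x_k)\mapsto\prod_j tr(N_j)\;\sigma^{-1}\circ M_1\otimes M_2\otimes\cdots\otimes M_n,$$ where $\sigma\in S_n$, the $N_j$ are finitely many monomials and $M_1,\dots,M_n$ are (possibly empty, i.e. equal to $1$) monomials in the matrix variables $x_1,\dots,x_k$. In other words, for $X=\{x_1,\dots,x_k\}$, the map $\pi_n:T\langle X\rangle^{\otimes n}\ltimes\mathbb Q[S_n]\to\mathcal T^n_X(V)$ from the symbolic algebra to the algebra of equivariant maps is surjective.
   Context: $GL(V)$ acts on $End(V)^k$ by simultaneous conjugation and on $End(V)^{\otimes n}=End(V^{\otimes n})$ by the diagonal conjugation action. $\mathcal T^n_X(V)$ is the algebra (under the multiplication of $End(V)^{\otimes n}$) of $GL(V)$-equivariant polynomial maps $End(V)^k\to End(V)^{\otimes n}$. A permutation $\sigma\in S_n$ is identified with the operator $v_1\otimes\cdots\otimes v_n\mapsto v_{\sigma^{-1}(1)}\otimes\cdots\otimes v_{\sigma^{-1}(n)}$ in $End(V^{\otimes n})$. $T\langle X\rangle=\mathbb Q\langle X\rangle[tr(M)]$ is the free algebra with trace: the polynomial algebra over the free associative unital algebra $\mathbb Q\langle X\rangle$ in commuting central indeterminates $tr(M)$, one for each cyclic equivalence class of monomials $M$. $T\langle X\rangle^{\otimes n}$ is its $n$-fold tensor product over $\mathbb Q[tr(M)]$. $T\langle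 X\rangle^{\otimes n}\ltimes\mathbb Q[S_n]$ is $T\langle X\rangle^{\otimes n}\otimes\mathbb Q[S_n]$ with commutation relations $\sigma\circ M_1\otimes\cdots\otimes M_n=M_{\sigma^{-1}(1)}\otimes\cdots\otimes M_{\sigma^{-1}(n)}\circ\sigma$. The homomorphism $\pi_n$ sends each symbolic element to the map obtained by evaluating the variables $x_i$ in matrices (equivalently, in generic matrices), formal traces as traces, and $\sigma\in S_n$ as the operator $v_1\otimes\cdots\otimes v_n\mapsto v_{\sigma^{-1}(1)}\otimes\cdots\otimes v_{\sigma^{-1}(n)}$ in $End(V^{\otimes n})$. *)

theory Defs
  imports
    "HOL-Analysis.Analysis"
    "HOL-Combinatorics.Perm"
    "HOL-Library.Poly_Mapping"
    "HOL-Library.Multiset"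
begin

unbundle permutation_syntax

text \<open>
  Conventions. The finite types \<open>'d\<close>, \<open>'k\<close>, \<open>'n\<close> (automatically nonempty) index the standard basis
  of \<open>V = \<rat>\<^sup>d\<close>, the matrix variables, and the tensor factors. \<open>End(V)\<close> is the type of \<open>d \<times> d\<close> matrices
  over the rationals. The basis vectors \<open>e\<^sub>f = \<Otimes>\<^sub>i e\<^bsub>f i\<^esub>\<close> of the \<open>n\<close>-th tensor power of \<open>V\<close> are indexed by
  \<open>f :: 'n \<Rightarrow> 'd\<close>, so \<open>End(V)\<^sup>\<otimes>\<^sup>n = End(V\<^sup>\<otimes>\<^sup>n)\<close> is the type of matrices indexed by \<open>'n \<Rightarrow> 'd\<close>.
  Note that \<open>*\<close> on the type \<open>vec\<close> is componentwise; composition of endomorphisms is \<open>**\<close>.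
\<close>

type_synonym 'd endo = "rat ^ 'd ^ 'd"
type_synonym ('d, 'k) endo_tuple = "'d endo ^ 'k"
type_synonym ('d, 'n) tensor_endo = "('n \<Rightarrow> 'd) endo"

definition smult_mat :: "'a::times \<Rightarrow> 'a ^ 'p ^ 'q \<Rightarrow> 'a ^ 'p ^ 'q"  (infixr \<open>*m\<close> 70)
  where "c *m A = (\<chi> i j. c * A $ i $ j)"


section \<open>Equivariant polynomial maps\<close>

definition tensor_endo :: "('n::finite \<Rightarrow> 'd::finite endo) \<Rightarrow> ('d, 'n) tensor_endo"
  where "tensor_endo A = (\<chi> f g. \<Prod>i\<in>UNIV. A i $ f i $ g i)"

text \<open>
  The operator \<open>v\<^sub>1 \<otimes> \<dots> \<otimes> v\<^sub>n \<mapsto> v\<^bsub>\<sigma>\<inverse>(1)\<^esub> \<otimes> \<dots> \<otimes> v\<^bsub>\<sigma>\<inverse>(n)\<^esub>\<close>, i.e. \<open>e\<^sub>g \<mapsto> e\<^bsub>g \<circ> \<sigma>\<inverse>\<^esub>\<close>.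
\<close>
definition perm_endo :: "'n::finite perm \<Rightarrow> ('d::finite, 'n) tensor_endo"
  where "perm_endo \<sigma> = (\<chi> f g. if f = g \<circ> apply (inverse \<sigma>) then 1 else 0)"

text \<open>
  Polynomial functions in the entries of a tuple of matrices, in the style of
  \<^const>\<open>real_polynomial_function\<close>.
\<close>
inductive polynomial_fun :: "(('d::finite, 'k::finite) endo_tuple \<Rightarrow> rat) \<Rightarrow> bool"
  where
    const: "polynomial_fun (\<lambda>x. c)"
  | coord: "polynomial_fun (\<lambda>x. x $ l $ i $ j)"
  | add: "polynomial_fun p \<Longrightarrow> polynomial_fun q \<Longrightarrow> polynomial_fun (\<lambda>x. p x + q x)"
  | mult: "polynomial_fun p \<Longrightarrow> polynomial_fun q \<Longrightarrow> polynomial_fun (\<lambda>x. p x * q x)"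

definition polynomial_map ::
    "(('d::finite, 'k::finite) endo_tuple \<Rightarrow> ('d, 'n::finite) tensor_endo) \<Rightarrow> bool"
  where "polynomial_map H \<longleftrightarrow> (\<forall>f g. polynomial_fun (\<lambda>x. H x $ f $ g))"

definition conj_tuple ::
    "'d::finite endo \<Rightarrow> ('d, 'k::finite) endo_tuple \<Rightarrow> ('d, 'k) endo_tuple"
  where "conj_tuple g x = (\<chi> l. g ** x $ l ** matrix_inv g)"

definition conj_tensor ::
    "'d::finite endo \<Rightarrow> ('d, 'n::finite) tensor_endo \<Rightarrow> ('d, 'n) tensor_endo"
  where "conj_tensor g T = tensor_endo (\<lambda>_. g) ** T ** tensor_endo (\<lambda>_. matrix_inv g)"

definition equivariant ::
    "(('d::finite, 'k::finite) endo_tuple \<Rightarrow> ('d, 'n::finite) tensor_endo) \<Rightarrow> bool"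
  where "equivariant H \<longleftrightarrow>
    (\<forall>g. invertible g \<longrightarrow> (\<forall>x. H (conj_tuple g x) = conj_tensor g (H x)))"

text \<open>The underlying set of the algebra \<open>\<T>\<^sup>n\<^sub>X(V)\<close>, whose operations are pointwise.\<close>
definition equivariant_maps ::
    "(('d::finite, 'k::finite) endo_tuple \<Rightarrow> ('d, 'n::finite) tensor_endo) set"
  where "equivariant_maps = {H. polynomial_map H \<and> equivariant H}"


section \<open>The symbolic algebra\<close>

text \<open>
  A monomial in the noncommuting variables \<open>X\<close> is a word \<open>w :: 'k list\<close>; the empty word is \<open>1\<close>.
  Two monomials are cyclically equivalent iff one is a rotation of the other.
\<close>

definition cyclic_equiv :: "'k list \<Rightarrow> 'k list \<Rightarrow> bool"
  where "cyclic_equiv u v \<longleftrightarrow> (\<exists>m. v = rotate m u)"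

lemma equivp_cyclic_equiv: "equivp (cyclic_equiv :: 'a list \<Rightarrow> 'a list \<Rightarrow> bool)"
proof (rule equivpI)
  show "reflp (cyclic_equiv :: 'a list \<Rightarrow> 'a list \<Rightarrow> bool)"
    unfolding reflp_def cyclic_equiv_def by (metis rotate0 id_apply)
  show "symp (cyclic_equiv :: 'a list \<Rightarrow> 'a list \<Rightarrow> bool)"
  proof (rule sympI)
    fix u v :: "'a list"
    assume "cyclic_equiv u v"
    then obtain m where v: "v = rotate m u"
      by (auto simp: cyclic_equiv_def)
    have "rotate (length u - m mod length u) v = u"
    proof (cases "u = []")
      case False
      then have "m mod length u < length u" by simp
      then have "rotate (length u - m mod length u) (rotate (m mod length u) u) = u"
        by (simp add: rotate_rotate)
      then show ?thesis by (simp add: v flip: rotate_conv_mod)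
    qed (simp add: v)
    then show "cyclic_equiv v u"
      unfolding cyclic_equiv_def by metis
  qed
  show "transp (cyclic_equiv :: 'a list \<Rightarrow> 'a list \<Rightarrow> bool)"
    by (rule transpI) (auto simp: cyclic_equiv_def rotate_rotate)
qed

quotient_type 'k cyclic_word = "'k list" / cyclic_equiv
  by (rule equivp_cyclic_equiv)

text \<open>
  \<open>\<rat>[tr(M)]\<close>: the monoid algebra of the free commutative monoid on the cyclic words, a multiset
  \<open>{#c\<^sub>1, \<dots>, c\<^sub>r#}\<close> standing for \<open>tr(c\<^sub>1) \<cdots> tr(c\<^sub>r)\<close>. The product of \<^typ>\<open>'a \<Rightarrow>\<^sub>0 'b\<close> is convolution with
  respect to addition on \<^typ>\<open>'a\<close>.
\<close>
type_synonym 'k trace_ring = "'k cyclic_word multiset \<Rightarrow>\<^sub>0 rat"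

text \<open>
  \<open>T\<langle>X\<rangle>\<close> is free over \<open>\<rat>[tr(M)]\<close> on the words, hence \<open>T\<langle>X\<rangle>\<^sup>\<otimes>\<^sup>n\<close> (over \<open>\<rat>[tr(M)]\<close>) is free on the tensors
  \<open>M\<^sub>1 \<otimes> \<dots> \<otimes> M\<^sub>n\<close> of words, and \<open>T\<langle>X\<rangle>\<^sup>\<otimes>\<^sup>n \<ltimes> \<rat>[S\<^sub>n]\<close> is free on the products \<open>M\<^sub>1 \<otimes> \<dots> \<otimes> M\<^sub>n \<circ> \<sigma>\<close>, written
  \<open>Tensor_Word M \<sigma>\<close> below. These form a monoid under
  \<open>(M\<^sub>1 \<otimes> \<dots> \<otimes> M\<^sub>n \<circ> \<sigma>) \<circ> (N\<^sub>1 \<otimes> \<dots> \<otimes> N\<^sub>n \<circ> \<tau>) = M\<^sub>1 N\<^bsub>\<sigma>\<inverse>(1)\<^esub> \<otimes> \<dots> \<otimes> M\<^sub>n N\<^bsub>\<sigma>\<inverse>(n)\<^esub> \<circ> \<sigma>\<tau>\<close>,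
  and the symbolic algebra is the monoid algebra over \<open>\<rat>[tr(M)]\<close>. The (noncommutative) monoid is
  written additively because this is what \<^typ>\<open>'a \<Rightarrow>\<^sub>0 'b\<close> requires of its exponents.
\<close>
datatype ('k, 'n) tensor_word = Tensor_Word (tw_words: "'n \<Rightarrow> 'k list") (tw_perm: "'n perm")

instantiation tensor_word :: (type, type) monoid_add
begin

definition zero_tensor_word :: "('a, 'b) tensor_word"
  where "0 = Tensor_Word (\<lambda>_. []) 1"

definition plus_tensor_word ::
    "('a, 'b) tensor_word \<Rightarrow> ('a, 'b) tensor_word \<Rightarrow> ('a, 'b) tensor_word"
  where "a + b =
    Tensor_Word (\<lambda>i. tw_words a i @ tw_words b (apply (inverse (tw_perm a)) i))
      (tw_perm a * tw_perm b)"

instance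
  by standard
    (auto simp: plus_tensor_word_def zero_tensor_word_def apply_times mult.assoc
      intro: tensor_word.expand)

end

type_synonym ('k, 'n) symbolic = "('k, 'n) tensor_word \<Rightarrow>\<^sub>0 'k trace_ring"

definition symb_words :: "('n \<Rightarrow> 'k list) \<Rightarrow> ('k, 'n) symbolic"
  where "symb_words M = Poly_Mapping.single (Tensor_Word M 1) 1"

definition symb_perm :: "'n perm \<Rightarrow> ('k, 'n) symbolic"
  where "symb_perm \<sigma> = Poly_Mapping.single (Tensor_Word (\<lambda>_. []) \<sigma>) 1"

definition symb_coeff :: "'k trace_ring \<Rightarrow> ('k, 'n) symbolic"
  where "symb_coeff r = Poly_Mapping.single 0 r"

lemma symb_perm_words:
  "symb_perm \<sigma> * symb_words M = symb_words (\<lambda>i. M (apply (inverse \<sigma>) i)) * symb_perm \<sigma>"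
  by (simp add: symb_perm_def symb_words_def mult_single plus_tensor_word_def)

lemma symb_words_mult:
  "symb_words M * symb_words N = symb_words (\<lambda>i. M i @ N i)"
  by (simp add: symb_words_def mult_single plus_tensor_word_def)

lemma symb_perm_mult: "symb_perm \<sigma> * symb_perm \<tau> = symb_perm (\<sigma> * \<tau>)"
  by (simp add: symb_perm_def mult_single plus_tensor_word_def)

lemma symb_basis:
  "Poly_Mapping.single (Tensor_Word M \<sigma>) r = symb_coeff r * symb_words M * symb_perm \<sigma>"
  by (simp add: symb_perm_def symb_words_def symb_coeff_def mult_single plus_tensor_word_def
      zero_tensor_word_def)


section \<open>Evaluation in matrices\<close>

definition word_eval :: "('d::finite, 'k::finite) endo_tuple \<Rightarrow> 'k list \<Rightarrow> 'd endo"
  where "word_eval x w = foldr (\<lambda>l A. x $ l ** A) w (mat 1)"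

lemma word_eval_append: "word_eval x (u @ v) = word_eval x u ** word_eval x v"
  by (induction u) (simp_all add: word_eval_def matrix_mul_assoc)

lift_definition cyclic_trace :: "('d::finite, 'k::finite) endo_tuple \<Rightarrow> 'k cyclic_word \<Rightarrow> rat"
  is "\<lambda>x w. trace (word_eval x w)"
proof -
  fix x :: "('d, 'k) endo_tuple" and u v :: "'k list"
  assume "cyclic_equiv u v"
  then obtain m where "v = rotate m u"
    by (auto simp: cyclic_equiv_def)
  then have v: "v = drop (m mod length u) u @ take (m mod length u) u"
    by (simp add: rotate_drop_take)
  have "trace (word_eval x v) =
      trace (word_eval x (take (m mod length u) u @ drop (m mod length u) u))"
    unfolding v word_eval_append by (rule trace_mul_sym)
  then show "trace (word_eval x u) = trace (word_eval x v)"
    by simp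
qed

definition trace_ring_eval :: "('d::finite, 'k::finite) endo_tuple \<Rightarrow> 'k trace_ring \<Rightarrow> rat"
  where "trace_ring_eval x r =
    (\<Sum>t\<in>Poly_Mapping.keys r. Poly_Mapping.lookup r t * (\<Prod>c\<in>#t. cyclic_trace x c))"

definition tensor_word_eval ::
    "('d::finite, 'k::finite) endo_tuple \<Rightarrow> ('k, 'n::finite) tensor_word \<Rightarrow> ('d, 'n) tensor_endo"
  where "tensor_word_eval x b =
    tensor_endo (\<lambda>i. word_eval x (tw_words b i)) ** perm_endo (tw_perm b)"

text \<open>The homomorphism \<open>\<pi>\<^sub>n\<close>.\<close>
definition symb_eval ::
    "('k::finite, 'n::finite) symbolic \<Rightarrow> ('d::finite, 'k) endo_tuple \<Rightarrow> ('d, 'n) tensor_endo"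
  where "symb_eval s x =
    (\<Sum>b\<in>Poly_Mapping.keys s.
      trace_ring_eval x (Poly_Mapping.lookup s b) *m tensor_word_eval x b)"

lemma smult_mat_sum_left: "(\<Sum>a\<in>A. f a) *m (T :: rat ^ 'p ^ 'q) = (\<Sum>a\<in>A. f a *m T)"
  by (simp add: smult_mat_def vec_eq_iff sum_distrib_right)

lemma smult_mat_add_left: "(a + b) *m (T :: rat ^ 'p ^ 'q) = a *m T + b *m T"
  by (simp add: smult_mat_def vec_eq_iff algebra_simps)

lemma smult_mat_zero_left [simp]: "0 *m (T :: rat ^ 'p ^ 'q) = 0"
  by (simp add: smult_mat_def vec_eq_iff)

lemma smult_mat_one_left [simp]: "1 *m (T :: rat ^ 'p ^ 'q) = T"
  by (simp add: smult_mat_def vec_eq_iff)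

lemma smult_mat_mult:
  "(a *m A) ** (b *m B) = (a * b) *m ((A :: rat ^ 'p::finite ^ 'q) ** B)"
  by (simp add: smult_mat_def matrix_matrix_mult_def vec_eq_iff sum_distrib_left mult_ac)

lemma poly_mapping_sum_single:
  "p = (\<Sum>k\<in>Poly_Mapping.keys p. Poly_Mapping.single k (Poly_Mapping.lookup p k))"
  by (rule poly_mapping_eqI)
    (auto simp: lookup_sum lookup_single when_def in_keys_iff)

lemma trace_ring_eval_zero [simp]: "trace_ring_eval x 0 = 0"
  by (simp add: trace_ring_eval_def)

lemma trace_ring_eval_add: "trace_ring_eval x (r + s) = trace_ring_eval x r + trace_ring_eval x s"
  unfolding trace_ring_eval_def
  by (rule setsum_keys_plus_distrib) (simp_all add: algebra_simps)

lemma trace_ring_eval_sum: "trace_ring_eval x (sum f A) = (\<Sum>a\<in>A. trace_ring_eval x (f a))"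
  by (induction A rule: infinite_finite_induct) (simp_all add: trace_ring_eval_add)

lemma trace_ring_eval_single:
  "trace_ring_eval x (Poly_Mapping.single t q) = q * (\<Prod>c\<in>#t. cyclic_trace x c)"
  by (simp add: trace_ring_eval_def)

lemma trace_ring_eval_one [simp]: "trace_ring_eval x 1 = 1"
  using trace_ring_eval_single[of x 0 1] by simp

lemma trace_ring_eval_mult:
  fixes r s :: "'k::finite trace_ring"
  shows "trace_ring_eval x (r * s) = trace_ring_eval x r * trace_ring_eval x s"
proof -
  have "trace_ring_eval x ((\<Sum>k\<in>A. Poly_Mapping.single k (f k)) * (\<Sum>k\<in>B. Poly_Mapping.single k (g k)))
      = trace_ring_eval x (\<Sum>k\<in>A. Poly_Mapping.single k (f k)) *
        trace_ring_eval x (\<Sum>k\<in>B. Poly_Mapping.single k (g k))"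
    for A B and f g :: "'k cyclic_word multiset \<Rightarrow> rat"
    by (simp add: sum_product mult_single trace_ring_eval_sum trace_ring_eval_single mult_ac)
  from this[where A = "Poly_Mapping.keys r" and f = "Poly_Mapping.lookup r"
      and B = "Poly_Mapping.keys s" and g = "Poly_Mapping.lookup s"]
  show ?thesis
    by (simp only: flip: poly_mapping_sum_single)
qed

text \<open>\<^const>\<open>symb_eval\<close> is a unital algebra homomorphism with the prescribed values on generators.\<close>

lemma tensor_endo_mult: "tensor_endo A ** tensor_endo B = tensor_endo (\<lambda>i. A i ** B i)"
proof -
  have "(\<Sum>h\<in>UNIV. (\<Prod>i\<in>UNIV. A i $ f i $ h i) * (\<Prod>i\<in>UNIV. B i $ h i $ g i)) =
      (\<Prod>i\<in>UNIV. \<Sum>j\<in>UNIV. A i $ f i $ j * B i $ j $ g i)" for f g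
    using prod_sum_PiE[of UNIV "\<lambda>_. UNIV" "\<lambda>i j. A i $ f i $ j * B i $ j $ g i"]
    by (simp add: PiE_UNIV_domain prod.distrib)
  then show ?thesis
    by (simp add: tensor_endo_def matrix_matrix_mult_def vec_eq_iff)
qed

lemma tensor_endo_one: "tensor_endo (\<lambda>_. mat 1) = mat 1"
proof -
  have "(\<Prod>i\<in>UNIV. if f i = g i then 1 else 0) = (if f = g then 1 else (0::rat))"
    for f g :: "'a \<Rightarrow> 'b"
    by (auto simp: fun_eq_iff)
  then show ?thesis
    by (simp add: tensor_endo_def mat_def vec_eq_iff)
qed

lemma perm_endo_one: "perm_endo 1 = mat 1"
  by (simp add: perm_endo_def mat_def vec_eq_iff apply_inverse)

lemma apply_inverse_apply [simp]: "apply \<sigma> (apply (inverse \<sigma>) i) = i"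
  "apply (inverse \<sigma>) (apply \<sigma> i) = i"
  by (simp_all add: apply_sequence)

lemma perm_endo_mult: "perm_endo \<sigma> ** perm_endo \<tau> = perm_endo (\<sigma> * \<tau>)"
  by (simp add: perm_endo_def matrix_matrix_mult_def vec_eq_iff apply_times o_assoc
      if_distrib[where f = "\<lambda>a. _ * a"] cong: if_cong)

lemma perm_endo_tensor_endo:
  "perm_endo \<sigma> ** tensor_endo A = tensor_endo (\<lambda>i. A (apply (inverse \<sigma>) i)) ** perm_endo \<sigma>"
proof -
  have eq: "f = h \<circ> apply (inverse \<sigma>) \<longleftrightarrow> h = f \<circ> apply \<sigma>" for f h :: "'a \<Rightarrow> 'b"
    by (auto simp: fun_eq_iff)
  have bij: "bij_betw (apply \<sigma>) UNIV UNIV"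
    by simp
  have "(\<Prod>i\<in>UNIV. A i $ f (apply \<sigma> i) $ g i) =
      (\<Prod>i\<in>UNIV. A (apply (inverse \<sigma>) i) $ f i $ g (apply (inverse \<sigma>) i))" for f g
    by (subst prod.reindex_bij_betw[OF bij, symmetric]) simp
  moreover have "(perm_endo \<sigma> ** tensor_endo A) $ f $ g =
      (\<Prod>i\<in>UNIV. A i $ f (apply \<sigma> i) $ g i)" for f g
    by (simp add: perm_endo_def tensor_endo_def matrix_matrix_mult_def eq
        if_distrib[where f = "\<lambda>a. a * _"] cong: if_cong)
  moreover have "(tensor_endo B ** perm_endo \<sigma>) $ f $ g =
      (\<Prod>i\<in>UNIV. B i $ f i $ g (apply (inverse \<sigma>) i))" for B :: "'a \<Rightarrow> 'b endo" and f g
    by (simp add: perm_endo_def tensor_endo_def matrix_matrix_mult_def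
        if_distrib[where f = "\<lambda>a. _ * a"] cong: if_cong)
  ultimately show ?thesis
    by (simp add: vec_eq_iff)
qed

lemma tensor_word_eval_zero: "tensor_word_eval x 0 = mat 1"
  by (simp add: tensor_word_eval_def zero_tensor_word_def word_eval_def tensor_endo_one
      perm_endo_one)

lemma tensor_word_eval_add:
  "tensor_word_eval x (a + b) = tensor_word_eval x a ** tensor_word_eval x b"
proof -
  have "tensor_word_eval x a ** tensor_word_eval x b =
      tensor_endo (\<lambda>i. word_eval x (tw_words a i)) **
        (perm_endo (tw_perm a) ** tensor_endo (\<lambda>i. word_eval x (tw_words b i))) **
        perm_endo (tw_perm b)"
    by (simp add: tensor_word_eval_def matrix_mul_assoc)
  also have "\<dots> = (tensor_endo (\<lambda>i. word_eval x (tw_words a i)) **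
        tensor_endo (\<lambda>i. word_eval x (tw_words b (apply (inverse (tw_perm a)) i)))) **
        (perm_endo (tw_perm a) ** perm_endo (tw_perm b))"
    by (simp add: perm_endo_tensor_endo matrix_mul_assoc)
  also have "\<dots> = tensor_word_eval x (a + b)"
    by (simp add: tensor_endo_mult perm_endo_mult tensor_word_eval_def plus_tensor_word_def
        word_eval_append)
  finally show ?thesis by simp
qed

lemma symb_eval_zero [simp]: "symb_eval 0 x = 0"
  by (simp add: symb_eval_def)

lemma symb_eval_add: "symb_eval (s + t) x = symb_eval s x + symb_eval t x"
  unfolding symb_eval_def
  by (rule setsum_keys_plus_distrib) (simp_all add: trace_ring_eval_add smult_mat_add_left)

lemma symb_eval_sum: "symb_eval (sum f A) x = (\<Sum>a\<in>A. symb_eval (f a) x)"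
  by (induction A rule: infinite_finite_induct) (simp_all add: symb_eval_add)

lemma symb_eval_single:
  "symb_eval (Poly_Mapping.single b r) x = trace_ring_eval x r *m tensor_word_eval x b"
  by (simp add: symb_eval_def)

lemma symb_eval_one: "symb_eval 1 x = mat 1"
  using symb_eval_single[of 0 1 x] by (simp add: tensor_word_eval_zero)

lemma matrix_mult_sum_sum:
  "sum f A ** sum g B = (\<Sum>a\<in>A. \<Sum>b\<in>B. (f a :: rat ^ 'p::finite ^ 'q::finite) ** g b)"
proof -
  have 1: "sum f A ** T = (\<Sum>a\<in>A. f a ** T)" for T :: "rat ^ 'r ^ 'p"
    by (induction A rule: infinite_finite_induct)
      (simp_all add: matrix_matrix_mult_def vec_eq_iff sum.distrib algebra_simps)
  have 2: "T ** sum g B = (\<Sum>b\<in>B. T ** g b)" for T :: "rat ^ 'p ^ 'q"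
    by (induction B rule: infinite_finite_induct)
      (simp_all add: matrix_matrix_mult_def vec_eq_iff sum.distrib algebra_simps)
  show ?thesis by (subst 1) (simp add: 2)
qed

lemma symb_eval_mult:
  fixes s t :: "('k::finite, 'n::finite) symbolic"
  shows "symb_eval (s * t) x = symb_eval s x ** symb_eval t x"
proof -
  have "symb_eval ((\<Sum>k\<in>A. Poly_Mapping.single k (f k)) * (\<Sum>k\<in>B. Poly_Mapping.single k (g k))) x
      = symb_eval (\<Sum>k\<in>A. Poly_Mapping.single k (f k)) x **
        symb_eval (\<Sum>k\<in>B. Poly_Mapping.single k (g k)) x"
    for A B and f g :: "('k, 'n) tensor_word \<Rightarrow> 'k trace_ring"
    by (simp add: sum_product mult_single symb_eval_sum symb_eval_single matrix_mult_sum_sum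
        smult_mat_mult trace_ring_eval_mult tensor_word_eval_add)
  from this[where A = "Poly_Mapping.keys s" and f = "Poly_Mapping.lookup s"
      and B = "Poly_Mapping.keys t" and g = "Poly_Mapping.lookup t"]
  show ?thesis
    by (simp only: flip: poly_mapping_sum_single)
qed

lemma symb_eval_words: "symb_eval (symb_words M) x = tensor_endo (\<lambda>i. word_eval x (M i))"
  by (simp add: symb_words_def symb_eval_single tensor_word_eval_def perm_endo_one)

lemma symb_eval_perm: "symb_eval (symb_perm \<sigma>) x = perm_endo \<sigma>"
  by (simp add: symb_perm_def symb_eval_single tensor_word_eval_def word_eval_def tensor_endo_one)

lemma symb_eval_coeff: "symb_eval (symb_coeff r) x = trace_ring_eval x r *m mat 1"
  by (simp add: symb_coeff_def symb_eval_single tensor_word_eval_zero)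

lemma trace_ring_eval_generator:
  "trace_ring_eval x (Poly_Mapping.single {#abs_cyclic_word w#} 1) = trace (word_eval x w)"
  by (simp add: trace_ring_eval_single cyclic_trace.abs_eq)

end

theory Submission
  imports Defs
begin

text \<open>
  The full polarization of an equivariant polynomial map \<open>H\<close> of degree at most \<open>m\<close> is an equivariant
  multilinear map of \<open>m\<close> tuples, and on the diagonal it is \<open>m!\<close> times the part of \<open>H\<close> of degree \<open>m\<close>; so,
  by induction on the degree, it suffices to treat multilinear maps. Once the variables \<open>l\<^sub>1, \<dots>, l\<^sub>m\<close> in
  the \<open>m\<close> slots are fixed, the coefficients of such a map form an endomorphism of \<open>V\<^bsup>\<otimes>(n+m)\<^esup>\<close> which
  commutes with \<open>GL(V)\<close>. By Schur--Weyl duality it is a combination of permutations \<open>\<tau>\<close> of \<open>n + m\<close> points.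
  Contracting \<open>\<tau>\<close> with the matrices in the \<open>m\<close> slots produces a trace for each cycle inside the \<open>m\<close>
  points, and a word for each of the \<open>n\<close> paths that start and end in the other points.
\<close>

section \<open>Polarization\<close>

text \<open>The ground field is \<open>rat\<close>, so arguments that need an algebraically closed
  field or a compact group do not apply to the double commutant theorem. Complete reducibility is
  replaced by the positivity of sums of squares, which holds over every ordered field. When there
  are more than \<open>d\<close> tensor factors, the permutation operators are linearly dependent
  and their Gram matrix is singular; it cannot be inverted, and only its range is used.

  Equivariance is given for invertible matrices and involves an inverse. Moving the inverse to the
  other side makes the condition polynomial in the matrix, and it then extends to all matrices, in
  particular to the singular sums of matrix units needed for the commutant.

  Inclusion-exclusion is used twice: on tensor powers of a matrix, to reach symmetrized matrix
  units, and on \<open>H\<close>. In the second use it kills the terms of low degree by itself and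
  is built from values of \<open>H\<close>, so the homogeneous parts of \<open>H\<close> need not be
  shown equivariant beforehand.\<close>

lemma sum_alternating_supersets:
  assumes "finite M" "R \<subseteq> M"
  shows "(\<Sum>S\<in>Pow M. if R \<subseteq> S then (-1) ^ card (M - S) else 0) =
    (if R = M then 1 else 0 :: 'r::comm_ring_1)"
proof -
  \<comment> \<open>The sum is the expansion of the product of all \<open>1 + h x\<close>; these
    factors are 1 on \<open>R\<close> and 0 off \<open>R\<close>.\<close>
  define h :: "'a \<Rightarrow> 'r" where "h x = (if x \<in> R then 0 else -1)" for x
  have "(\<Prod>x\<in>M - S. h x) = (if R \<subseteq> S then (-1) ^ card (M - S) else 0)" if "S \<subseteq> M" for S
  proof (cases "R \<subseteq> S")
    case True
    then have "(\<Prod>x\<in>M - S. h x) = (\<Prod>x\<in>M - S. -1)"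
      by (intro prod.cong) (auto simp: h_def)
    then show ?thesis using True by simp
  next
    case False
    then obtain y where "y \<in> R" "y \<notin> S" by blast
    then have "(\<Prod>x\<in>M - S. h x) = 0"
      using assms by (intro prod_zero) (auto simp: h_def)
    then show ?thesis using False by simp
  qed
  then have "(\<Sum>S\<in>Pow M. if R \<subseteq> S then (-1) ^ card (M - S) else 0) = (\<Prod>x\<in>M. 1 + h x)"
    by (subst prod_add[OF assms(1)]) (auto intro!: sum.cong)
  also have "\<dots> = (if R = M then 1 else 0)"
  proof (cases "R = M")
    case False
    then obtain y where "y \<in> M" "y \<notin> R" using assms by blast
    then have "(\<Prod>x\<in>M. 1 + h x) = 0"
      using assms by (intro prod_zero) (auto simp: h_def)
    then show ?thesis using False by simp
  qed (auto simp: h_def intro!: prod.neutral)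
  finally show ?thesis .
qed

text \<open>Inclusion-exclusion over the image: expanding the product of sums gives the maps into
  \<open>S\<close>, and the alternating sum over \<open>S\<close> keeps those with image exactly
  \<open>M\<close>.\<close>

lemma polarization:
  fixes a :: "'s \<Rightarrow> 't \<Rightarrow> 'r::comm_ring_1"
  assumes "finite L" "finite M"
  shows "(\<Sum>S\<in>Pow M. (-1) ^ card (M - S) * (\<Prod>s\<in>L. \<Sum>t\<in>S. a s t)) =
    (\<Sum>\<pi> | \<pi> \<in> L \<rightarrow>\<^sub>E M \<and> \<pi> ` L = M. \<Prod>s\<in>L. a s (\<pi> s))"
proof -
  have fin: "finite (L \<rightarrow>\<^sub>E M)"
    using assms by (intro finite_PiE) auto
  have prod_sum: "(\<Prod>s\<in>L. \<Sum>t\<in>S. a s t) =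
      (\<Sum>\<pi>\<in>L \<rightarrow>\<^sub>E M. if \<pi> ` L \<subseteq> S then \<Prod>s\<in>L. a s (\<pi> s) else 0)" if "S \<subseteq> M" for S
  proof -
    have "(\<Prod>s\<in>L. \<Sum>t\<in>S. a s t) = (\<Sum>\<pi>\<in>L \<rightarrow>\<^sub>E S. \<Prod>s\<in>L. a s (\<pi> s))"
      using assms that by (intro prod_sum_PiE) (auto intro: finite_subset)
    also have "L \<rightarrow>\<^sub>E S = {\<pi> \<in> L \<rightarrow>\<^sub>E M. \<pi> ` L \<subseteq> S}"
      using that by (auto simp: PiE_def Pi_def)
    finally show ?thesis
      using fin by (simp add: sum.inter_filter)
  qed
  have "(\<Sum>S\<in>Pow M. (-1) ^ card (M - S) * (\<Prod>s\<in>L. \<Sum>t\<in>S. a s t)) =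
      (\<Sum>S\<in>Pow M. \<Sum>\<pi>\<in>L \<rightarrow>\<^sub>E M.
        (if \<pi> ` L \<subseteq> S then (-1) ^ card (M - S) else 0) * (\<Prod>s\<in>L. a s (\<pi> s)))"
    by (auto simp: prod_sum sum_distrib_left intro!: sum.cong)
  also have "\<dots> = (\<Sum>\<pi>\<in>L \<rightarrow>\<^sub>E M. (if \<pi> ` L = M then 1 else 0) * (\<Prod>s\<in>L. a s (\<pi> s)))"
  proof (subst sum.swap, rule sum.cong)
    fix \<pi> assume "\<pi> \<in> L \<rightarrow>\<^sub>E M"
    then have "\<pi> ` L \<subseteq> M" by auto
    from sum_alternating_supersets[OF assms(2) this, where 'r = 'r]
    show "(\<Sum>S\<in>Pow M. (if \<pi> ` L \<subseteq> S then (-1) ^ card (M - S) else 0) * (\<Prod>s\<in>L. a s (\<pi> s))) =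
        (if \<pi> ` L = M then 1 else 0) * (\<Prod>s\<in>L. a s (\<pi> s))"
      by (simp flip: sum_distrib_right)
  qed simp
  also have "\<dots> = (\<Sum>\<pi> | \<pi> \<in> L \<rightarrow>\<^sub>E M \<and> \<pi> ` L = M. \<Prod>s\<in>L. a s (\<pi> s))"
    using fin by (simp add: sum.inter_filter if_distrib[of "\<lambda>c. c * _"] cong: if_cong)
  finally show ?thesis .
qed

text \<open>No map from a smaller set is onto \<open>M\<close>; this is what removes terms of lower
  degree.\<close>

lemma polarization_small:
  fixes a :: "'s \<Rightarrow> 't \<Rightarrow> 'r::comm_ring_1"
  assumes "finite L" "finite M" "card L < card M"
  shows "(\<Sum>S\<in>Pow M. (-1) ^ card (M - S) * (\<Prod>s\<in>L. \<Sum>t\<in>S. a s t)) = 0"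
proof -
  have "\<pi> ` L \<noteq> M" for \<pi>
    using assms card_image_le[of L \<pi>] by auto
  then show ?thesis
    by (simp add: polarization[OF assms(1,2)])
qed

text \<open>A surjection of a finite set onto itself is a bijection. The witnesses only translate
  between the value \<open>undefined\<close> and the identity outside \<open>M\<close>.\<close>

lemma polarization_permutes:
  fixes a :: "'s \<Rightarrow> 's \<Rightarrow> 'r::comm_ring_1"
  assumes "finite M"
  shows "(\<Sum>S\<in>Pow M. (-1) ^ card (M - S) * (\<Prod>s\<in>M. \<Sum>t\<in>S. a s t)) =
    (\<Sum>\<pi> | \<pi> permutes M. \<Prod>s\<in>M. a s (\<pi> s))"
  unfolding polarization[OF assms assms]
proof (rule sum.reindex_bij_witness[of _ "\<lambda>\<pi>. restrict \<pi> M" "\<lambda>\<pi> x. if x \<in> M then \<pi> x else x"])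
  fix \<pi> assume "\<pi> \<in> {\<pi>. \<pi> \<in> M \<rightarrow>\<^sub>E M \<and> \<pi> ` M = M}"
  then have \<pi>: "\<pi> \<in> M \<rightarrow>\<^sub>E M" "\<pi> ` M = M" by auto
  then show "restrict (\<lambda>x. if x \<in> M then \<pi> x else x) M = \<pi>"
    by (auto simp: fun_eq_iff PiE_def extensional_def)
  have "bij_betw \<pi> M M"
    using \<pi>(2) assms by (simp add: bij_betw_def eq_card_imp_inj_on)
  then have "bij_betw (\<lambda>x. if x \<in> M then \<pi> x else x) M M"
    by (subst bij_betw_cong[of _ _ \<pi>]) auto
  then show "(\<lambda>x. if x \<in> M then \<pi> x else x) \<in> {\<pi>. \<pi> permutes M}"
    by (auto intro: bij_imp_permutes)
  show "(\<Prod>s\<in>M. a s (if s \<in> M then \<pi> s else s)) = (\<Prod>s\<in>M. a s (\<pi> s))"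
    by (intro prod.cong) auto
next
  fix \<pi> assume "\<pi> \<in> {\<pi>. \<pi> permutes M}"
  then have \<pi>: "\<pi> permutes M" by simp
  then show "(\<lambda>x. if x \<in> M then restrict \<pi> M x else x) = \<pi>"
    by (auto simp: fun_eq_iff permutes_not_in)
  show "restrict \<pi> M \<in> {\<pi>. \<pi> \<in> M \<rightarrow>\<^sub>E M \<and> \<pi> ` M = M}"
    using permutes_image[OF \<pi>] by auto
qed

section \<open>Schur--Weyl duality over an ordered field\<close>

text \<open>Gram-Schmidt without independence: the induction hypothesis is applied to
  \<open>u\<close> and to the new vector \<open>v s\<close>, and the residual of \<open>u\<close> is
  then corrected along the residual of \<open>v s\<close>.\<close>

lemma orthogonal_decomposition:
  fixes v :: "'s \<Rightarrow> 'x \<Rightarrow> 'f::linordered_field"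
  assumes "finite S" "finite X"
  shows "\<exists>c. \<forall>s\<in>S. (\<Sum>x\<in>X. (u x - (\<Sum>t\<in>S. c t * v t x)) * v s x) = 0"
  using assms(1)
proof (induction S arbitrary: u rule: finite_induct)
  case (insert s S)
  from insert.IH[of u] obtain c where
    c: "\<And>t. t \<in> S \<Longrightarrow> (\<Sum>x\<in>X. (u x - (\<Sum>t\<in>S. c t * v t x)) * v t x) = 0" by blast
  from insert.IH[of "v s"] obtain e where
    e: "\<And>t. t \<in> S \<Longrightarrow> (\<Sum>x\<in>X. (v s x - (\<Sum>t\<in>S. e t * v t x)) * v t x) = 0" by blast
  define r where "r x = u x - (\<Sum>t\<in>S. c t * v t x)" for x
  define w where "w x = v s x - (\<Sum>t\<in>S. e t * v t x)" for x
  define k where "k = (\<Sum>x\<in>X. r x * w x) / (\<Sum>x\<in>X. w x * w x)"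
  define c' where "c' t = (if t = s then k else c t - k * e t)" for t
  have residual: "u x - (\<Sum>t\<in>insert s S. c' t * v t x) = r x - k * w x" for x
  proof -
    have "(\<Sum>t\<in>insert s S. c' t * v t x) = k * v s x + (\<Sum>t\<in>S. (c t - k * e t) * v t x)"
      using insert.hyps by (auto simp: c'_def intro!: sum.cong)
    then show ?thesis
      by (simp add: r_def w_def algebra_simps sum_subtractf sum_distrib_left)
  qed
  have orth: "(\<Sum>x\<in>X. (r x - k * w x) * v t x) = 0" if "t \<in> S" for t
  proof -
    have "(\<Sum>x\<in>X. (r x - k * w x) * v t x) = (\<Sum>x\<in>X. r x * v t x) - k * (\<Sum>x\<in>X. w x * v t x)"
      by (simp add: algebra_simps sum_subtractf sum_distrib_left)
    then show ?thesis
      using c[OF that] e[OF that] by (simp flip: r_def w_def)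
  qed
  have "(\<Sum>x\<in>X. (r x - k * w x) * w x) = 0"
  \<comment> \<open>If \<open>v s\<close> already lies in the span of the others, \<open>w\<close>
    vanishes on \<open>X\<close> and the value of the quotient \<open>k\<close> does not
    matter.\<close>
  proof (cases "(\<Sum>x\<in>X. w x * w x) = 0")
    case True
    then have "\<forall>x\<in>X. w x = 0"
      by (subst (asm) sum_nonneg_eq_0_iff) (use assms in auto)
    then show ?thesis by simp
  next
    case False
    have "(\<Sum>x\<in>X. (r x - k * w x) * w x) = (\<Sum>x\<in>X. r x * w x) - k * (\<Sum>x\<in>X. w x * w x)"
      by (simp add: algebra_simps sum_subtractf sum_distrib_left)
    then show ?thesis using False by (simp add: k_def)
  qed
  moreover have "(\<Sum>x\<in>X. (r x - k * w x) * (\<Sum>t\<in>S. e t * v t x)) = 0"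
  proof -
    have "(\<Sum>x\<in>X. (r x - k * w x) * (\<Sum>t\<in>S. e t * v t x)) =
        (\<Sum>t\<in>S. e t * (\<Sum>x\<in>X. (r x - k * w x) * v t x))"
      by (simp only: sum_distrib_left, subst sum.swap) (simp add: mult_ac)
    then show ?thesis by (simp add: orth)
  qed
  ultimately have "(\<Sum>x\<in>X. (r x - k * w x) * (w x + (\<Sum>t\<in>S. e t * v t x))) = 0"
    unfolding distrib_left sum.distrib by simp
  then have "(\<Sum>x\<in>X. (r x - k * w x) * v s x) = 0"
    by (simp add: w_def)
  with orth show ?case
    by (intro exI[of _ c']) (simp only: residual, auto)
qed simp

text \<open>If \<open>v\<close> denotes the matrix with rows \<open>v s\<close>, then \<open>v\<^sup>T\<close> and \<open>v\<^sup>T v v\<^sup>T\<close> have the same range, because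
  the standard bilinear form over an ordered field is positive definite.\<close>
lemma family_in_span_gram:
  fixes v :: "'s \<Rightarrow> 'x \<Rightarrow> 'f::linordered_field"
  assumes "finite S" "finite X" "r \<in> S"
  shows "\<exists>c. \<forall>x\<in>X. v r x = (\<Sum>s\<in>S. c s * (\<Sum>t\<in>S. (\<Sum>y\<in>X. v t y * v s y) * v t x))"
proof -
  define \<theta> where "\<theta> s x = (\<Sum>t\<in>S. (\<Sum>y\<in>X. v t y * v s y) * v t x)" for s x
  obtain c where c: "\<And>s. s \<in> S \<Longrightarrow> (\<Sum>x\<in>X. (v r x - (\<Sum>t\<in>S. c t * \<theta> t x)) * \<theta> s x) = 0"
    using orthogonal_decomposition[OF assms(1,2), of "v r" \<theta>] by blast
  \<comment> \<open>The residual is orthogonal to every \<open>\<theta> s\<close> and is itself a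
    combination of the \<open>v s\<close>, with coefficients \<open>q\<close>. These two facts force
    it to vanish on \<open>X\<close>.\<close>
  define R where "R x = v r x - (\<Sum>t\<in>S. c t * \<theta> t x)" for x
  define ip where "ip t = (\<Sum>x\<in>X. R x * v t x)" for t
  obtain q where q: "\<And>x. R x = (\<Sum>s\<in>S. q s * v s x)"
  proof
    fix x
    let ?q = "\<lambda>s. (if s = r then 1 else 0) - (\<Sum>t\<in>S. c t * (\<Sum>y\<in>X. v s y * v t y))"
    have "(\<Sum>t\<in>S. c t * \<theta> t x) = (\<Sum>s\<in>S. (\<Sum>t\<in>S. c t * (\<Sum>y\<in>X. v s y * v t y)) * v s x)"
      unfolding \<theta>_def sum_distrib_left sum_distrib_right by (subst sum.swap) (simp add: mult_ac)
    then show "R x = (\<Sum>s\<in>S. ?q s * v s x)"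
      using assms by (simp add: R_def left_diff_distrib sum_subtractf
        if_distrib[of "\<lambda>c. c * _"] cong: if_cong)
  qed
  have gram: "(\<Sum>x\<in>X. R x * \<theta> s x) = (\<Sum>t\<in>S. (\<Sum>y\<in>X. v t y * v s y) * ip t)" for s
    unfolding \<theta>_def ip_def sum_distrib_left by (subst sum.swap) (simp add: mult_ac)
  \<comment> \<open>Expanding one factor \<open>ip t\<close> through \<open>q\<close> and using the
    symmetry of the Gram matrix turns the squared length of \<open>ip\<close> into pairings of
    \<open>R\<close> with the \<open>\<theta> s\<close>, all of which are zero.\<close>
  have "(\<Sum>t\<in>S. ip t * ip t) = (\<Sum>s\<in>S. q s * (\<Sum>x\<in>X. R x * \<theta> s x))"
  proof -
    have ip: "ip t = (\<Sum>s\<in>S. q s * (\<Sum>y\<in>X. v t y * v s y))" for t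
      unfolding ip_def q sum_distrib_left sum_distrib_right by (subst sum.swap) (simp add: mult_ac)
    have "(\<Sum>t\<in>S. ip t * ip t) = (\<Sum>t\<in>S. (\<Sum>s\<in>S. q s * (\<Sum>y\<in>X. v t y * v s y)) * ip t)"
      by (simp only: ip[symmetric])
    also have "\<dots> = (\<Sum>t\<in>S. \<Sum>s\<in>S. q s * ((\<Sum>y\<in>X. v t y * v s y) * ip t))"
      by (simp only: sum_distrib_right mult.assoc)
    also have "\<dots> = (\<Sum>s\<in>S. \<Sum>t\<in>S. q s * ((\<Sum>y\<in>X. v t y * v s y) * ip t))"
      by (rule sum.swap)
    finally show ?thesis
      by (simp only: gram sum_distrib_left)
  qed
  also have "\<dots> = 0"
    by (simp add: c[folded R_def])
  finally have ip0: "\<forall>t\<in>S. ip t = 0"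
    by (subst (asm) sum_nonneg_eq_0_iff) (use assms in auto)
  have "(\<Sum>x\<in>X. R x * R x) = (\<Sum>x\<in>X. R x * (\<Sum>s\<in>S. q s * v s x))"
    by (simp only: q[symmetric])
  also have "\<dots> = (\<Sum>s\<in>S. q s * ip s)"
    unfolding ip_def sum_distrib_left by (subst sum.swap) (simp add: mult_ac)
  also have "\<dots> = 0"
    using ip0 by simp
  finally have "\<forall>x\<in>X. R x = 0"
    by (subst (asm) sum_nonneg_eq_0_iff) (use assms in auto)
  then show ?thesis
    by (intro exI[of _ c]) (simp add: R_def \<theta>_def)
qed

lemma comp_permutes_in_PiE:
  assumes "b \<in> I \<rightarrow>\<^sub>E A" "\<tau> permutes I"
  shows "b \<circ> \<tau> \<in> I \<rightarrow>\<^sub>E A"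
  using assms PiE_arb[OF assms(1)] by (intro PiE_I) (auto simp: permutes_in_image permutes_not_in)

lemma PiE_eq_iff:
  assumes "a \<in> I \<rightarrow>\<^sub>E A" "b \<in> I \<rightarrow>\<^sub>E B"
  shows "a = b \<longleftrightarrow> (\<forall>i\<in>I. a i = b i)"
  using assms by (auto intro: PiE_ext)

lemma prod_indicator:
  assumes "finite I"
  shows "(\<Prod>i\<in>I. if P i then 1 else 0) = (if \<forall>i\<in>I. P i then 1 else 0 :: 'f::comm_semiring_1)"
  using assms by (induction I rule: finite_induct) auto

text \<open>The double commutant theorem for the group algebra of \<open>S\<^sub>I\<close> on \<open>V\<^bsup>\<otimes>I\<^esup>\<close>. By polarization, \<open>T\<close> commutes
  with every symmetrized matrix unit; left multiplication by \<open>T\<close> therefore maps each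
  \<open>\<Sum>\<^sub>\<tau> tr(\<sigma>\<inverse> \<tau>) \<tau>\<close> into the span of the permutations, and the identity is a combination of these.\<close>
theorem schur_weyl:
  fixes T :: "('i \<Rightarrow> 'd::finite) \<Rightarrow> ('i \<Rightarrow> 'd) \<Rightarrow> 'f::linordered_field"
  assumes fin: "finite I"
    and comm: "\<And>G a b. a \<in> I \<rightarrow>\<^sub>E UNIV \<Longrightarrow> b \<in> I \<rightarrow>\<^sub>E UNIV \<Longrightarrow>
      (\<Sum>c\<in>I \<rightarrow>\<^sub>E UNIV. T a c * (\<Prod>i\<in>I. G (c i) (b i))) =
      (\<Sum>c\<in>I \<rightarrow>\<^sub>E UNIV. (\<Prod>i\<in>I. G (a i) (c i)) * T c b)"
  shows "\<exists>k. \<forall>a\<in>I \<rightarrow>\<^sub>E UNIV. \<forall>b\<in>I \<rightarrow>\<^sub>E UNIV.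
    T a b = (\<Sum>\<tau> | \<tau> permutes I. k \<tau> * (if a = b \<circ> \<tau> then 1 else 0))"
proof -
  define F where "F = (I \<rightarrow>\<^sub>E (UNIV :: 'd set))"
  define S where "S = {\<tau>. \<tau> permutes I}"
  have finF: "finite F" and finS: "finite S"
    using fin by (auto simp: F_def S_def intro: finite_PiE finite_permutations)
  have compF: "b \<circ> \<tau> \<in> F" if "b \<in> F" "\<tau> \<in> S" for b \<tau>
    using that comp_permutes_in_PiE[of b I UNIV \<tau>] by (simp add: F_def S_def)
  have eqF: "(\<forall>i\<in>I. b (\<tau> i) = c i) \<longleftrightarrow> c = b \<circ> \<tau>" if "b \<in> F" "c \<in> F" "\<tau> \<in> S" for b c \<tau>
    using PiE_eq_iff[of c I UNIV "b \<circ> \<tau>" UNIV] that compF[OF that(1,3)]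
    by (auto simp: F_def)

  \<comment> \<open>This is the entry at \<open>(a, e)\<close> of the commutation of
    \<open>T\<close> with the sum over \<open>\<tau>\<close> of the matrix units at
    \<open>(b \<circ> \<tau>, d \<circ> \<tau>)\<close>.\<close>
  have star: "(\<Sum>\<tau>\<in>S. if e = d \<circ> \<tau> then T a (b \<circ> \<tau>) else 0) =
      (\<Sum>\<tau>\<in>S. if a = b \<circ> \<tau> then T (d \<circ> \<tau>) e else 0)"
    if "a \<in> F" "b \<in> F" "d \<in> F" "e \<in> F" for a b d e
  proof -
    \<comment> \<open>\<open>G U\<close> is the sum of the matrix units at \<open>(b t, d t)\<close>
      for \<open>t \<in> U\<close>; the alternating sum of its tensor powers is the symmetrized
      unit. These matrices can be singular, so \<open>comm\<close> must hold for all
      matrices.\<close>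
    define G where "G U p q = (\<Sum>t\<in>U. if b t = p \<and> d t = q then 1 else (0::'f))" for U p q
    have G: "(\<Sum>U\<in>Pow I. (-1) ^ card (I - U) * (\<Prod>i\<in>I. G U (c i) (c' i))) =
        (\<Sum>\<tau>\<in>S. if c = b \<circ> \<tau> \<and> c' = d \<circ> \<tau> then 1 else 0)" if "c \<in> F" "c' \<in> F" for c c'
    proof -
      have "(\<Sum>U\<in>Pow I. (-1) ^ card (I - U) * (\<Prod>i\<in>I. G U (c i) (c' i))) =
          (\<Sum>\<tau>\<in>S. \<Prod>i\<in>I. if b (\<tau> i) = c i \<and> d (\<tau> i) = c' i then 1 else 0)"
        unfolding G_def S_def by (rule polarization_permutes[OF fin])
      also have "\<dots> = (\<Sum>\<tau>\<in>S. if c = b \<circ> \<tau> \<and> c' = d \<circ> \<tau> then 1 else 0)"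
        using that \<open>b \<in> F\<close> \<open>d \<in> F\<close>
        by (intro sum.cong) (auto simp: prod_indicator[OF fin] simp flip: eqF)
      finally show ?thesis .
    qed
    have "(\<Sum>c\<in>F. T a c * (\<Sum>U\<in>Pow I. (-1) ^ card (I - U) * (\<Prod>i\<in>I. G U (c i) (e i)))) =
        (\<Sum>U\<in>Pow I. (-1) ^ card (I - U) * (\<Sum>c\<in>F. T a c * (\<Prod>i\<in>I. G U (c i) (e i))))"
      unfolding sum_distrib_left by (subst sum.swap) (simp add: mult_ac)
    also have "\<dots> = (\<Sum>U\<in>Pow I. (-1) ^ card (I - U) * (\<Sum>c\<in>F. (\<Prod>i\<in>I. G U (a i) (c i)) * T c e))"
      using comm[folded F_def, OF \<open>a \<in> F\<close> \<open>e \<in> F\<close>] by simp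
    also have "\<dots> = (\<Sum>c\<in>F. (\<Sum>U\<in>Pow I. (-1) ^ card (I - U) * (\<Prod>i\<in>I. G U (a i) (c i))) * T c e)"
      unfolding sum_distrib_left sum_distrib_right by (subst sum.swap) (simp add: mult_ac)
    finally have "(\<Sum>c\<in>F. T a c * (\<Sum>\<tau>\<in>S. if c = b \<circ> \<tau> \<and> e = d \<circ> \<tau> then 1 else 0)) =
        (\<Sum>c\<in>F. (\<Sum>\<tau>\<in>S. if a = b \<circ> \<tau> \<and> c = d \<circ> \<tau> then 1 else 0) * T c e)"
      using G that by simp
    moreover have "(\<Sum>c\<in>F. T a c * (\<Sum>\<tau>\<in>S. if c = b \<circ> \<tau> \<and> e = d \<circ> \<tau> then 1 else 0)) =
        (\<Sum>\<tau>\<in>S. \<Sum>c\<in>F. if c = b \<circ> \<tau> then if e = d \<circ> \<tau> then T a c else 0 else 0)"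
      unfolding sum_distrib_left by (subst sum.swap) (auto intro!: sum.cong)
    moreover have "(\<Sum>c\<in>F. (\<Sum>\<tau>\<in>S. if a = b \<circ> \<tau> \<and> c = d \<circ> \<tau> then 1 else 0) * T c e) =
        (\<Sum>\<tau>\<in>S. \<Sum>c\<in>F. if c = d \<circ> \<tau> then if a = b \<circ> \<tau> then T c e else 0 else 0)"
      unfolding sum_distrib_right by (subst sum.swap) (auto intro!: sum.cong)
    ultimately show ?thesis
      using that compF finF by (simp add: sum.delta)
  qed

  \<comment> \<open>Putting \<open>e = d \<circ> \<sigma>\<close> in \<open>star\<close> and summing
    over \<open>d\<close> produces the coefficients \<open>gram\<close> on the left, where
    \<open>T\<close> multiplies permutation operators, and \<open>\<kappa>\<close> on the right,
    where only permutation operators remain.\<close>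
  define gram where "gram \<tau> \<sigma> = (\<Sum>d\<in>F. if d \<circ> \<tau> = d \<circ> \<sigma> then 1 else (0::'f))"
    for \<tau> \<sigma> :: "'i \<Rightarrow> 'i"
  define \<kappa> where "\<kappa> \<sigma> \<tau> = (\<Sum>d\<in>F. T (d \<circ> \<tau>) (d \<circ> \<sigma>))"
    for \<sigma> \<tau> :: "'i \<Rightarrow> 'i"
  have mult_T: "(\<Sum>\<tau>\<in>S. gram \<tau> \<sigma> * T a (b \<circ> \<tau>)) = (\<Sum>\<tau>\<in>S. \<kappa> \<sigma> \<tau> * (if a = b \<circ> \<tau> then 1 else 0))"
    if "a \<in> F" "b \<in> F" "\<sigma> \<in> S" for a b \<sigma>
  proof -
    have "(\<Sum>\<tau>\<in>S. gram \<tau> \<sigma> * T a (b \<circ> \<tau>)) =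
        (\<Sum>d\<in>F. \<Sum>\<tau>\<in>S. if d \<circ> \<sigma> = d \<circ> \<tau> then T a (b \<circ> \<tau>) else 0)"
      unfolding gram_def sum_distrib_right by (subst sum.swap) (auto intro!: sum.cong)
    also have "\<dots> = (\<Sum>d\<in>F. \<Sum>\<tau>\<in>S. if a = b \<circ> \<tau> then T (d \<circ> \<tau>) (d \<circ> \<sigma>) else 0)"
      using that compF by (intro sum.cong star) auto
    also have "\<dots> = (\<Sum>\<tau>\<in>S. \<kappa> \<sigma> \<tau> * (if a = b \<circ> \<tau> then 1 else 0))"
      unfolding \<kappa>_def sum_distrib_right by (subst sum.swap) (auto intro!: sum.cong)
    finally show ?thesis .
  qed

  \<comment> \<open>The permutation operators flattened to vectors of matrix entries; their inner
    products are the values of \<open>gram\<close>.\<close>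
  define v where "v \<tau> = (\<lambda>(e, b :: 'i \<Rightarrow> 'd). if e = b \<circ> \<tau> then 1 else (0::'f))" for \<tau> :: "'i \<Rightarrow> 'i"
  have "id \<in> S" by (simp add: S_def)
  from family_in_span_gram[OF finS _ this, of "F \<times> F" v] finF obtain c where
    c: "\<And>x. x \<in> F \<times> F \<Longrightarrow>
      v id x = (\<Sum>s\<in>S. c s * (\<Sum>t\<in>S. (\<Sum>y\<in>F \<times> F. v t y * v s y) * v t x))"
    by blast
  have gram: "(\<Sum>y\<in>F \<times> F. v \<tau> y * v \<sigma> y) = gram \<tau> \<sigma>" if "\<tau> \<in> S" "\<sigma> \<in> S" for \<tau> \<sigma>
  proof -
    have "(\<Sum>y\<in>F \<times> F. v \<tau> y * v \<sigma> y) =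
        (\<Sum>e\<in>F. \<Sum>d\<in>F. if e = d \<circ> \<tau> then if d \<circ> \<tau> = d \<circ> \<sigma> then 1 else 0 else 0)"
      unfolding sum.cartesian_product by (intro sum.cong) (auto simp: v_def)
    also have "\<dots> = gram \<tau> \<sigma>"
      unfolding gram_def using that finF compF by (subst sum.swap) (simp add: sum.delta)
    finally show ?thesis .
  qed
  have one: "(if e = b then 1 else 0) =
      (\<Sum>\<sigma>\<in>S. c \<sigma> * (\<Sum>\<tau>\<in>S. gram \<tau> \<sigma> * (if e = b \<circ> \<tau> then 1 else 0)))"
    if "e \<in> F" "b \<in> F" for e b
  proof -
    have "(if e = b then 1 else 0) = v id (e, b)"
      by (simp add: v_def)
    also have "\<dots> = (\<Sum>s\<in>S. c s * (\<Sum>t\<in>S. gram t s * v t (e, b)))"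
      using c[of "(e, b)"] that by (simp add: gram)
    finally show ?thesis by (simp add: v_def)
  qed
  \<comment> \<open>Write \<open>T\<close> as \<open>T\<close> times the identity, expand the
    identity by \<open>one\<close>, and apply \<open>mult_T\<close> to each term.\<close>
  have "T a b = (\<Sum>\<tau>\<in>S. (\<Sum>\<sigma>\<in>S. c \<sigma> * \<kappa> \<sigma> \<tau>) * (if a = b \<circ> \<tau> then 1 else 0))"
    if "a \<in> F" "b \<in> F" for a b
  proof -
    have "T a b = (\<Sum>e\<in>F. T a e * (if e = b then 1 else 0))"
      using that finF by (simp add: if_distrib[of "\<lambda>c. _ * c"] cong: if_cong)
    also have "\<dots> = (\<Sum>e\<in>F. T a e * (\<Sum>\<sigma>\<in>S. c \<sigma> * (\<Sum>\<tau>\<in>S. gram \<tau> \<sigma> * (if e = b \<circ> \<tau> then 1 else 0))))"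
      using one that by simp
    also have "\<dots> = (\<Sum>\<sigma>\<in>S. c \<sigma> * (\<Sum>\<tau>\<in>S. gram \<tau> \<sigma> * (\<Sum>e\<in>F. T a e * (if e = b \<circ> \<tau> then 1 else 0))))"
      unfolding sum_distrib_left
      by (subst sum.swap, intro sum.cong refl, subst sum.swap) (simp add: mult_ac)
    also have "\<dots> = (\<Sum>\<sigma>\<in>S. c \<sigma> * (\<Sum>\<tau>\<in>S. gram \<tau> \<sigma> * T a (b \<circ> \<tau>)))"
      using that finF compF by (simp add: if_distrib[of "\<lambda>c. _ * c"] cong: if_cong)
    also have "\<dots> = (\<Sum>\<sigma>\<in>S. c \<sigma> * (\<Sum>\<tau>\<in>S. \<kappa> \<sigma> \<tau> * (if a = b \<circ> \<tau> then 1 else 0)))"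
      using mult_T that by simp
    also have "\<dots> = (\<Sum>\<tau>\<in>S. (\<Sum>\<sigma>\<in>S. c \<sigma> * \<kappa> \<sigma> \<tau>) * (if a = b \<circ> \<tau> then 1 else 0))"
      unfolding sum_distrib_left sum_distrib_right by (subst sum.swap) (simp add: mult_ac)
    finally show ?thesis .
  qed
  then show ?thesis
    unfolding F_def S_def by (intro exI[of _ "\<lambda>\<tau>. \<Sum>\<sigma>\<in>{\<tau>. \<tau> permutes I}. c \<sigma> * \<kappa> \<sigma> \<tau>"]) (auto simp: S_def)
qed

section \<open>From invertible matrices to all matrices\<close>

lemma invertible_diagonally_shifted:
  fixes A :: "'f::linordered_field ^ 'd::finite ^ 'd"
  assumes t: "(\<Sum>i\<in>UNIV. \<Sum>j\<in>UNIV. \<bar>A $ i $ j\<bar>) < \<bar>t\<bar>"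
  shows "invertible (\<chi> i j. A $ i $ j + (if i = j then t else 0))"
proof -
  let ?B = "\<chi> i j. A $ i $ j + (if i = j then t else 0)"
  have "x = 0" if x: "?B *v x = 0" for x
  proof -
    \<comment> \<open>As for diagonally dominant matrices, a kernel vector is tested at a coordinate
      of maximal absolute value; the sum over all entries of \<open>A\<close> bounds every row at
      once.\<close>
    obtain i where i: "\<bar>x $ j\<bar> \<le> \<bar>x $ i\<bar>" for j
    proof -
      have "Max (range (\<lambda>j. \<bar>x $ j\<bar>)) \<in> range (\<lambda>j. \<bar>x $ j\<bar>)"
        by (intro Max_in) auto
      then obtain i where "Max (range (\<lambda>j. \<bar>x $ j\<bar>)) = \<bar>x $ i\<bar>" by blast
      then show ?thesis
        using that[of i] Max_ge[of "range (\<lambda>j. \<bar>x $ j\<bar>)"] by (metis finite finite_imageI rangeI)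
    qed
    have "(\<Sum>j\<in>UNIV. A $ i $ j * x $ j) + t * x $ i = (?B *v x) $ i"
      by (simp add: matrix_vector_mult_def distrib_right sum.distrib
          if_distrib[of "\<lambda>c. c * _"] cong: if_cong)
    then have "\<bar>t\<bar> * \<bar>x $ i\<bar> = \<bar>\<Sum>j\<in>UNIV. A $ i $ j * x $ j\<bar>"
      using x by (simp add: add_eq_0_iff2 flip: abs_mult)
    also have "\<dots> \<le> (\<Sum>j\<in>UNIV. \<bar>A $ i $ j\<bar> * \<bar>x $ i\<bar>)"
      by (rule order_trans[OF sum_abs]) (auto simp: abs_mult intro!: sum_mono mult_left_mono i)
    also have "\<dots> \<le> (\<Sum>i\<in>UNIV. \<Sum>j\<in>UNIV. \<bar>A $ i $ j\<bar>) * \<bar>x $ i\<bar>"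
      unfolding sum_distrib_right[symmetric]
      by (intro mult_right_mono member_le_sum[of i UNIV "\<lambda>i. \<Sum>j\<in>UNIV. \<bar>A $ i $ j\<bar>"])
        (auto intro: sum_nonneg)
    finally have "x $ i = 0"
      using t mult_strict_right_mono[OF t, of "\<bar>x $ i\<bar>"] by (cases "x $ i = 0") auto
    then show "x = 0"
      using i by (simp add: vec_eq_iff)
  qed
  then show ?thesis
    unfolding invertible_left_inverse matrix_left_invertible_ker by blast
qed

lemma poly_eq_0_if_large:
  fixes P :: "'f::linordered_field poly"
  assumes "\<And>t. b < t \<Longrightarrow> poly P t = 0"
  shows "P = 0"
proof (rule ccontr)
  assume "P \<noteq> 0"
  then have "finite {t. poly P t = 0}" by (rule poly_roots_finite)
  moreover have "{b<..} \<subseteq> {t. poly P t = 0}" using assms by auto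
  ultimately show False
    using infinite_Ioi[of b] finite_subset by blast
qed

text \<open>For any \<open>G\<close>, the matrix \<open>G\<close> plus \<open>t\<close> times the
  identity is invertible for large \<open>t\<close>, and each entry of the commutation relation is
  polynomial in \<open>t\<close>. An identity for all large \<open>t\<close> therefore holds at
  \<open>t = 0\<close>, that is, for \<open>G\<close> itself.\<close>

lemma schur_weyl_GL:
  fixes T :: "('i \<Rightarrow> 'd::finite) \<Rightarrow> ('i \<Rightarrow> 'd) \<Rightarrow> 'f::linordered_field"
  assumes fin: "finite I"
    and comm: "\<And>(g :: 'f ^ 'd ^ 'd) a b. invertible g \<Longrightarrow> a \<in> I \<rightarrow>\<^sub>E UNIV \<Longrightarrow> b \<in> I \<rightarrow>\<^sub>E UNIV \<Longrightarrow>
      (\<Sum>c\<in>I \<rightarrow>\<^sub>E UNIV. T a c * (\<Prod>i\<in>I. g $ c i $ b i)) =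
      (\<Sum>c\<in>I \<rightarrow>\<^sub>E UNIV. (\<Prod>i\<in>I. g $ a i $ c i) * T c b)"
  shows "\<exists>k. \<forall>a\<in>I \<rightarrow>\<^sub>E UNIV. \<forall>b\<in>I \<rightarrow>\<^sub>E UNIV.
    T a b = (\<Sum>\<tau> | \<tau> permutes I. k \<tau> * (if a = b \<circ> \<tau> then 1 else 0))"
proof (rule schur_weyl[OF fin])
  fix G :: "'d \<Rightarrow> 'd \<Rightarrow> 'f" and a b
  assume ab: "a \<in> I \<rightarrow>\<^sub>E (UNIV :: 'd set)" "b \<in> I \<rightarrow>\<^sub>E (UNIV :: 'd set)"
  define g where "g t = (\<chi> i j. (\<chi> i j. G i j) $ i $ j + (if i = j then t else 0))" for t
  define pg where "pg p q = [:G p q, if p = q then 1 else 0:]" for p q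
  have pg: "g t $ p $ q = poly (pg p q) t" for t p q
    by (simp add: g_def pg_def)
  define P where "P = (\<Sum>c\<in>I \<rightarrow>\<^sub>E UNIV. [:T a c:] * (\<Prod>i\<in>I. pg (c i) (b i))) -
    (\<Sum>c\<in>I \<rightarrow>\<^sub>E UNIV. (\<Prod>i\<in>I. pg (a i) (c i)) * [:T c b:])"
  have P: "poly P t = (\<Sum>c\<in>I \<rightarrow>\<^sub>E UNIV. T a c * (\<Prod>i\<in>I. g t $ c i $ b i)) -
      (\<Sum>c\<in>I \<rightarrow>\<^sub>E UNIV. (\<Prod>i\<in>I. g t $ a i $ c i) * T c b)" for t
    by (simp add: P_def pg poly_sum poly_prod mult.commute)
  have "P = 0"
  proof (rule poly_eq_0_if_large)
    fix t assume t: "(\<Sum>i\<in>UNIV. \<Sum>j\<in>UNIV. \<bar>(\<chi> i j. G i j) $ i $ j\<bar>) < t"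
    then have "invertible (g t)"
      unfolding g_def by (intro invertible_diagonally_shifted) linarith
    from comm[OF this ab] show "poly P t = 0"
      by (simp add: P)
  qed
  then show "(\<Sum>c\<in>I \<rightarrow>\<^sub>E UNIV. T a c * (\<Prod>i\<in>I. G (c i) (b i))) =
      (\<Sum>c\<in>I \<rightarrow>\<^sub>E UNIV. (\<Prod>i\<in>I. G (a i) (c i)) * T c b)"
    using P[of 0] by (simp add: g_def)
qed

section \<open>Contraction of permutations with matrices\<close>

lemma sum_PiE_insert:
  assumes "s \<notin> J"
  shows "(\<Sum>p\<in>insert s J \<rightarrow>\<^sub>E A. \<phi> p) = (\<Sum>p\<in>J \<rightarrow>\<^sub>E A. \<Sum>c\<in>A. \<phi> (p(s := c)))"
proof -
  have "inj_on (\<lambda>(c, p). p(s := c)) (A \<times> (J \<rightarrow>\<^sub>E A))"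
    using inj_combinator[OF assms, of "\<lambda>_. A"] by simp
  then have "(\<Sum>p\<in>insert s J \<rightarrow>\<^sub>E A. \<phi> p) = (\<Sum>(c, p)\<in>A \<times> (J \<rightarrow>\<^sub>E A). \<phi> (p(s := c)))"
    unfolding PiE_insert_eq by (subst sum.reindex) (auto simp: case_prod_unfold)
  also have "\<dots> = (\<Sum>p\<in>J \<rightarrow>\<^sub>E A. \<Sum>c\<in>A. \<phi> (p(s := c)))"
    by (subst sum.cartesian_product[symmetric], rule sum.swap)
  finally show ?thesis .
qed

text \<open>Summing over the index of one closed node \<open>s\<close> either closes the loop at \<open>s\<close>, which gives a trace,
  or merges \<open>s\<close> into its predecessor \<open>\<tau>\<inverse>(s)\<close>, which concatenates their words.\<close>
lemma contract_closed_nodes: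
  fixes w :: "'i \<Rightarrow> 'k::finite list"
  assumes "finite J" "finite A" "A \<inter> J = {}" "\<tau> permutes A \<union> J"
  shows "\<exists>N \<sigma> u. \<sigma> permutes A \<and> (\<forall>(x :: ('d::finite, 'k) endo_tuple) f g.
    (\<Sum>p\<in>J \<rightarrow>\<^sub>E UNIV. \<Prod>i\<in>A \<union> J.
      word_eval x (w i) $ override_on f p J i $ override_on g p J (\<tau> i)) =
    (\<Prod>v\<leftarrow>N. trace (word_eval x v)) * (\<Prod>i\<in>A. word_eval x (u i) $ f i $ g (\<sigma> i)))"
  using assms(1,3,4)
proof (induction J arbitrary: \<tau> w rule: finite_induct)
  case empty
  then show ?case
    by (intro exI[of _ "[]"] exI[of _ \<tau>] exI[of _ w]) simp
next
  case (insert s J)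
  define K where "K = A \<union> J"
  have K: "finite K" "s \<notin> K"
    using assms(2) insert by (auto simp: K_def)
  have \<tau>: "\<tau> permutes insert s K"
    using insert.prems by (simp add: K_def)
  \<comment> \<open>This cuts \<open>s\<close> out of its cycle: its predecessor is sent directly to
    \<open>\<tau> s\<close>, and \<open>s\<close> becomes fixed.\<close>
  define \<tau>' where "\<tau>' = Transposition.transpose s (\<tau> s) \<circ> \<tau>"
  have \<tau>': "\<tau>' permutes A \<union> J"
    using permutes_insert_lemma[OF \<tau>] by (simp add: \<tau>'_def K_def)
  have override: "override_on f (p(s := c)) (insert s J) = (override_on f p J)(s := c)"
    for f p :: "'i \<Rightarrow> 'd" and c
    by (auto simp: override_on_def)
  have split: "(\<Sum>p\<in>insert s J \<rightarrow>\<^sub>E UNIV. \<Prod>i\<in>A \<union> insert s J.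
        word_eval x (w i) $ override_on f p (insert s J) i $ override_on g p (insert s J) (\<tau> i)) =
      (\<Sum>p\<in>J \<rightarrow>\<^sub>E UNIV. \<Sum>c\<in>UNIV.
        word_eval x (w s) $ c $ ((override_on g p J)(s := c)) (\<tau> s) *
        (\<Prod>i\<in>K. word_eval x (w i) $ override_on f p J i $ ((override_on g p J)(s := c)) (\<tau> i)))"
    for x :: "('d, 'k) endo_tuple" and f g
  proof -
    have "A \<union> insert s J = insert s K" by (auto simp: K_def)
    moreover have "(\<Prod>i\<in>K. word_eval x (w i) $ ((override_on f p J)(s := c)) i $ h i) =
        (\<Prod>i\<in>K. word_eval x (w i) $ override_on f p J i $ h i)" for h p c
      using K by (intro prod.cong) auto
    ultimately show ?thesis
      using K insert.hyps by (simp add: sum_PiE_insert override del: fun_upd_apply)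
        (simp only: fun_upd_same)
  qed
  show ?case
  proof (cases "\<tau> s = s")
    case True
    then have "\<tau>' = \<tau>" by (simp add: \<tau>'_def)
    have neq: "\<tau> i \<noteq> s" if "i \<in> K" for i
      using permutes_inj[OF \<tau>] True that K by (metis injD)
    from insert.IH[OF _ \<tau>', of w] insert.prems obtain N \<sigma> u where \<sigma>: "\<sigma> permutes A"
      and eq: "\<And>(x :: ('d, 'k) endo_tuple) f g.
        (\<Sum>p\<in>J \<rightarrow>\<^sub>E UNIV. \<Prod>i\<in>K.
          word_eval x (w i) $ override_on f p J i $ override_on g p J (\<tau> i)) =
        (\<Prod>v\<leftarrow>N. trace (word_eval x v)) * (\<Prod>i\<in>A. word_eval x (u i) $ f i $ g (\<sigma> i))"
      unfolding \<open>\<tau>' = \<tau>\<close> K_def by auto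
    have "(\<Sum>p\<in>J \<rightarrow>\<^sub>E UNIV. \<Sum>c\<in>UNIV.
        word_eval x (w s) $ c $ ((override_on g p J)(s := c)) (\<tau> s) *
        (\<Prod>i\<in>K. word_eval x (w i) $ override_on f p J i $ ((override_on g p J)(s := c)) (\<tau> i))) =
      trace (word_eval x (w s)) * (\<Sum>p\<in>J \<rightarrow>\<^sub>E UNIV. \<Prod>i\<in>K.
          word_eval x (w i) $ override_on f p J i $ override_on g p J (\<tau> i))"
      for x :: "('d, 'k) endo_tuple" and f g
      using True neq by (simp add: trace_def sum_distrib_left sum_distrib_right)
    then show ?thesis
      unfolding split using \<sigma>
      by (intro exI[of _ "w s # N"] exI[of _ \<sigma>] exI[of _ u]) (simp add: eq mult.assoc)
  next
    case False
    define r where "r = inv \<tau> s"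
    have r: "\<tau> r = s"
      using permutes_inverses[OF \<tau>] by (simp add: r_def)
    have "r \<in> insert s K"
      using permutes_in_image[OF permutes_inv[OF \<tau>], of s] by (simp add: r_def)
    then have "r \<in> K" using r False by auto
    have neq: "\<tau> i \<noteq> s" if "i \<noteq> r" for i
      using permutes_inj[OF \<tau>] r that by (metis injD)
    have \<tau>'_r: "\<tau>' r = \<tau> s" using r by (simp add: \<tau>'_def)
    have \<tau>'_other: "\<tau>' i = \<tau> i" if "i \<in> K" "i \<noteq> r" for i
    proof -
      have "\<tau> i \<noteq> \<tau> s" using that K permutes_inj[OF \<tau>] by (metis injD)
      then show ?thesis using neq[OF that(2)] by (simp add: \<tau>'_def)
    qed
    \<comment> \<open>The column index at \<open>r\<close> and the row index at \<open>s\<close> are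
      the same summed index \<open>c\<close>, so the sum is a matrix product in this order.\<close>
    define w' where "w' = w(r := w r @ w s)"
    from insert.IH[OF _ \<tau>', of w'] insert.prems obtain N \<sigma> u where \<sigma>: "\<sigma> permutes A"
      and eq: "\<And>(x :: ('d, 'k) endo_tuple) f g.
        (\<Sum>p\<in>J \<rightarrow>\<^sub>E UNIV. \<Prod>i\<in>K.
          word_eval x (w' i) $ override_on f p J i $ override_on g p J (\<tau>' i)) =
        (\<Prod>v\<leftarrow>N. trace (word_eval x v)) * (\<Prod>i\<in>A. word_eval x (u i) $ f i $ g (\<sigma> i))"
      unfolding K_def by auto
    have "(\<Sum>c\<in>UNIV.
        word_eval x (w s) $ c $ (h(s := c)) (\<tau> s) *
        (\<Prod>i\<in>K. word_eval x (w i) $ k i $ (h(s := c)) (\<tau> i))) =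
      (\<Prod>i\<in>K. word_eval x (w' i) $ k i $ h (\<tau>' i))"
      for x :: "('d, 'k) endo_tuple" and h k
    proof -
      have "(\<Prod>i\<in>K. word_eval x (w i) $ k i $ (h(s := c)) (\<tau> i)) =
          word_eval x (w r) $ k r $ c * (\<Prod>i\<in>K - {r}. word_eval x (w i) $ k i $ h (\<tau> i))" for c
        using K \<open>r \<in> K\<close> r neq by (simp add: prod.remove)
      then have "(\<Sum>c\<in>UNIV. word_eval x (w s) $ c $ (h(s := c)) (\<tau> s) *
          (\<Prod>i\<in>K. word_eval x (w i) $ k i $ (h(s := c)) (\<tau> i))) =
        (\<Sum>c\<in>UNIV. word_eval x (w r) $ k r $ c * word_eval x (w s) $ c $ h (\<tau> s)) *
          (\<Prod>i\<in>K - {r}. word_eval x (w i) $ k i $ h (\<tau> i))"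
        using False by (simp add: sum_distrib_left mult_ac)
      also have "\<dots> = word_eval x (w' r) $ k r $ h (\<tau>' r) *
          (\<Prod>i\<in>K - {r}. word_eval x (w' i) $ k i $ h (\<tau>' i))"
        by (simp add: w'_def \<tau>'_r \<tau>'_other word_eval_append matrix_matrix_mult_def)
      also have "\<dots> = (\<Prod>i\<in>K. word_eval x (w' i) $ k i $ h (\<tau>' i))"
        using K \<open>r \<in> K\<close> by (simp add: prod.remove)
      finally show ?thesis .
    qed
    then show ?thesis
      unfolding split using \<sigma>
      by (intro exI[of _ N] exI[of _ \<sigma>] exI[of _ u]) (simp add: eq)
  qed
qed

section \<open>Trace monomials and their linear span\<close>

lemma smult_mat_nth [simp]: "(c *m A) $ i $ j = c * A $ i $ j"
  by (simp add: smult_mat_def)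

lemma matrix_mult_nth: "(A ** B) $ i $ j = (\<Sum>k\<in>UNIV. A $ i $ k * B $ k $ j)"
  by (simp add: matrix_matrix_mult_def)

lemma matrix_inv:
  assumes "invertible A"
  shows matrix_inv_right: "A ** matrix_inv A = mat 1" and matrix_inv_left: "matrix_inv A ** A = mat 1"
  using someI_ex[OF assms[unfolded invertible_def]] by (simp_all add: matrix_inv_def)

definition trace_monomial ::
    "'k list list \<times> 'n::finite perm \<times> ('n \<Rightarrow> 'k list) \<Rightarrow>
      ('d::finite, 'k::finite) endo_tuple \<Rightarrow> ('d, 'n) tensor_endo"
  where "trace_monomial = (\<lambda>(N, \<sigma>, M) x. (\<Prod>w\<leftarrow>N. trace (word_eval x w)) *m
    (perm_endo (inverse \<sigma>) ** tensor_endo (\<lambda>i. word_eval x (M i))))"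

definition trace_polynomials :: "(('d::finite, 'k::finite) endo_tuple \<Rightarrow> ('d, 'n::finite) tensor_endo) set"
  where "trace_polynomials =
    {H. \<exists>(m::nat) c t. \<forall>x. H x = (\<Sum>a<m. c a *m trace_monomial (t a) x)}"

lemma trace_polynomialsI:
  "(\<And>x. H x = (\<Sum>a<(m::nat). c a *m trace_monomial (t a) x)) \<Longrightarrow> H \<in> trace_polynomials"
  unfolding trace_polynomials_def by blast

lemma trace_polynomials_zero: "(\<lambda>x. 0) \<in> trace_polynomials"
  by (rule trace_polynomialsI[where m = 0]) simp

lemma trace_polynomials_monomial: "trace_monomial t \<in> trace_polynomials"
  by (rule trace_polynomialsI[where m = 1 and c = "\<lambda>_. 1" and t = "\<lambda>_. t"]) simp

lemma trace_polynomials_smult: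
  assumes "H \<in> trace_polynomials"
  shows "(\<lambda>x. r *m H x) \<in> trace_polynomials"
proof -
  obtain m :: nat and c t where "\<And>x. H x = (\<Sum>a<m. c a *m trace_monomial (t a) x)"
    using assms by (auto simp: trace_polynomials_def)
  then show ?thesis
    by (intro trace_polynomialsI[where m = m and c = "\<lambda>a. r * c a" and t = t])
      (simp add: vec_eq_iff sum_distrib_left mult.assoc)
qed

lemma trace_polynomials_add:
  fixes H H' :: "('d::finite, 'k::finite) endo_tuple \<Rightarrow> ('d, 'n::finite) tensor_endo"
  assumes "H \<in> trace_polynomials" "H' \<in> trace_polynomials"
  shows "(\<lambda>x. H x + H' x) \<in> trace_polynomials"
proof -
  obtain m :: nat and c t where H: "\<And>x. H x = (\<Sum>a<m. c a *m trace_monomial (t a) x)"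
    using assms by (auto simp: trace_polynomials_def)
  obtain m' :: nat and c' t' where H': "\<And>x. H' x = (\<Sum>a<m'. c' a *m trace_monomial (t' a) x)"
    using assms by (auto simp: trace_polynomials_def)
  have split: "(\<Sum>a<m + m'. if a < m then \<phi> a else \<psi> (a - m)) = (\<Sum>a<m. \<phi> a) + (\<Sum>a<m'. \<psi> a)"
    for \<phi> \<psi> :: "nat \<Rightarrow> ('d, 'n) tensor_endo"
    by (induction m') (simp_all add: add.assoc)
  have "H x + H' x = (\<Sum>a<m + m'. (if a < m then c a else c' (a - m)) *m
      trace_monomial (if a < m then t a else t' (a - m)) x)" for x
    unfolding H H' split[symmetric] by (intro sum.cong) auto
  then show ?thesis
    by (rule trace_polynomialsI)
qed

lemma trace_polynomials_sum:
  assumes "\<And>a. a \<in> A \<Longrightarrow> H a \<in> trace_polynomials"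
  shows "(\<lambda>x. \<Sum>a\<in>A. H a x) \<in> trace_polynomials"
  using assms
  by (induction A rule: infinite_finite_induct)
    (simp_all add: trace_polynomials_zero trace_polynomials_add)

lemma trace_monomial_nth:
  "trace_monomial (N, \<sigma>, M) x $ f $ g = (\<Prod>w\<leftarrow>N. trace (word_eval x w)) *
    (\<Prod>i\<in>UNIV. word_eval x (M i) $ f (apply (inverse \<sigma>) i) $ g i)"
proof -
  have "f = h \<circ> apply \<sigma> \<longleftrightarrow> h = f \<circ> apply (inverse \<sigma>)" for h
    by (auto simp: fun_eq_iff)
  moreover have "inverse (inverse \<sigma>) = \<sigma>"
    by (rule perm_eqI) (metis apply_inverse_apply)
  ultimately have "(perm_endo (inverse \<sigma>) ** T) $ f $ g = T $ (f \<circ> apply (inverse \<sigma>)) $ g" for T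
    by (simp add: perm_endo_def matrix_matrix_mult_def if_distrib[where f = "\<lambda>a. a * _"] cong: if_cong)
  then show ?thesis
    by (simp add: trace_monomial_def tensor_endo_def)
qed

text \<open>Reindexing the product by \<open>\<sigma>\<close> moves the permutation from the column
  indices to the row indices, where \<open>perm_endo\<close> can absorb it; the words
  \<open>u\<close> are reindexed along with it.\<close>

lemma prod_words_eq_trace_monomial:
  fixes \<sigma> :: "'n::finite \<Rightarrow> 'n"
  assumes "\<sigma> permutes UNIV"
  shows "\<exists>s M. \<forall>(x :: ('d::finite, 'k::finite) endo_tuple) f g.
    (\<Prod>w\<leftarrow>N. trace (word_eval x w)) * (\<Prod>i\<in>UNIV. word_eval x (u i) $ f i $ g (\<sigma> i)) =
    trace_monomial (N, s, M) x $ f $ g"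
proof -
  define s where "s = Perm \<sigma>"
  have s: "apply s = \<sigma>"
    using permutes_bij[OF assms] by (simp add: s_def Perm_inverse)
  have inv: "apply (inverse s) (\<sigma> i) = i" for i
    by (simp flip: s)
  have "(\<Prod>i\<in>UNIV. word_eval x (u i) $ f i $ g (\<sigma> i)) = (\<Prod>i\<in>UNIV.
      word_eval x (u (apply (inverse s) i)) $ f (apply (inverse s) i) $ g i)"
    for x :: "('d, 'k) endo_tuple" and f g
    by (subst prod.permute[OF assms]) (simp add: inv o_def)
  then show ?thesis
    by (intro exI[of _ s] exI[of _ "\<lambda>i. u (apply (inverse s) i)"]) (simp add: trace_monomial_nth)
qed

lemma case_sum_in_PiE_Plus:
  assumes "p \<in> A \<rightarrow>\<^sub>E B"
  shows "case_sum f p \<in> UNIV <+> A \<rightarrow>\<^sub>E UNIV"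
  using assms by (auto simp: PiE_def extensional_def split: sum.splits)

lemma PiE_Plus_cases:
  assumes "c \<in> UNIV <+> A \<rightarrow>\<^sub>E UNIV"
  obtains f p where "p \<in> A \<rightarrow>\<^sub>E UNIV" "c = case_sum f p"
proof
  show "c \<circ> Inr \<in> A \<rightarrow>\<^sub>E UNIV"
    using assms by (auto simp: PiE_def extensional_def)
  show "c = case_sum (c \<circ> Inl) (c \<circ> Inr)"
    by (auto simp: fun_eq_iff split: sum.splits)
qed

lemma sum_PiE_Plus:
  fixes \<phi> :: "('n::finite + 'a \<Rightarrow> 'd::finite) \<Rightarrow> 'f::comm_monoid_add"
  assumes "finite A"
  shows "(\<Sum>c\<in>UNIV <+> A \<rightarrow>\<^sub>E UNIV. \<phi> c) = (\<Sum>f\<in>UNIV. \<Sum>p\<in>A \<rightarrow>\<^sub>E UNIV. \<phi> (case_sum f p))"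
  unfolding sum.cartesian_product
proof (rule sum.reindex_bij_witness[of _ "\<lambda>(f, p). case_sum f p" "\<lambda>c. (c \<circ> Inl, c \<circ> Inr)"], goal_cases)
  case (1 c)
  then show ?case by (auto simp: fun_eq_iff split: sum.splits)
next
  case (2 c)
  then show ?case by (auto simp: PiE_def extensional_def)
next
  case (3 fp)
  then show ?case by (auto simp: fun_eq_iff)
next
  case (4 fp)
  then show ?case by (auto simp: PiE_def extensional_def split: sum.splits)
next
  case (5 c)
  have "case_sum (c \<circ> Inl) (c \<circ> Inr) = c"
    by (auto simp: fun_eq_iff split: sum.splits)
  then show ?case by simp
qed

text \<open>The \<open>Inl\<close> nodes are the tensor factors and stay open; the
  \<open>Inr\<close> nodes are the slots and are summed out by
  \<open>contract_closed_nodes\<close>.\<close>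

lemma contraction_eq_trace_monomial:
  fixes w :: "'n::finite + nat \<Rightarrow> 'k::finite list"
  assumes \<tau>: "\<tau> permutes UNIV <+> {..<m}"
  shows "\<exists>t. \<forall>(x :: ('d::finite, 'k) endo_tuple) f g.
    (\<Sum>p\<in>{..<m} \<rightarrow>\<^sub>E UNIV. \<Prod>i\<in>UNIV <+> {..<m}.
      word_eval x (w i) $ case_sum f p i $ case_sum g p (\<tau> i)) = trace_monomial t x $ f $ g"
proof -
  let ?A = "range Inl :: ('n + nat) set" and ?J = "Inr ` {..<m} :: ('n + nat) set"
  have AJ: "UNIV <+> {..<m} = ?A \<union> ?J"
    by (auto simp: Plus_def)
  have "finite ?J" "finite ?A" "?A \<inter> ?J = {}" "\<tau> permutes ?A \<union> ?J"
    using \<tau> by (auto simp: AJ)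
  from contract_closed_nodes[OF this, of w, where 'd = 'd] obtain N \<sigma> u where
    \<sigma>: "\<sigma> permutes ?A" and contract: "\<And>(x :: ('d, 'k) endo_tuple) f g.
      (\<Sum>p\<in>?J \<rightarrow>\<^sub>E UNIV. \<Prod>i\<in>?A \<union> ?J.
        word_eval x (w i) $ override_on f p ?J i $ override_on g p ?J (\<tau> i)) =
      (\<Prod>v\<leftarrow>N. trace (word_eval x v)) * (\<Prod>i\<in>?A. word_eval x (u i) $ f i $ g (\<sigma> i))"
    by blast
  define \<sigma>' where "\<sigma>' i = projl (\<sigma> (Inl i))" for i
  have \<sigma>': "\<sigma> (Inl i) = Inl (\<sigma>' i)" for i
    using permutes_in_image[OF \<sigma>, of "Inl i"] by (auto simp: \<sigma>'_def)
  have "inj \<sigma>'"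
    using permutes_inj[OF \<sigma>] \<sigma>' by (metis (mono_tags, lifting) Inl_inject injD injI)
  then have "\<sigma>' permutes UNIV"
    by (intro bij_imp_permutes) (auto simp: bij_betw_def finite_UNIV_inj_surj)
  from prod_words_eq_trace_monomial[OF this, of N "u \<circ> Inl", where 'd = 'd] obtain s M where
    monomial: "\<And>(x :: ('d, 'k) endo_tuple) f g.
      (\<Prod>w\<leftarrow>N. trace (word_eval x w)) * (\<Prod>i\<in>UNIV. word_eval x (u (Inl i)) $ f i $ g (\<sigma>' i)) =
      trace_monomial (N, s, M) x $ f $ g"
    by auto
  have "(\<Sum>p\<in>{..<m} \<rightarrow>\<^sub>E UNIV. \<Prod>i\<in>?A \<union> ?J.
      word_eval x (w i) $ case_sum f p i $ case_sum g p (\<tau> i)) = trace_monomial (N, s, M) x $ f $ g"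
    for x :: "('d, 'k) endo_tuple" and f g
  proof -
    \<comment> \<open>On the nodes below \<open>m\<close> the filler is overridden by
      \<open>p\<close>; on the other \<open>Inr\<close> nodes \<open>undefined\<close> is the value
      of the extensional \<open>p\<close> itself.\<close>
    let ?f = "case_sum f (\<lambda>_. undefined)" and ?g = "case_sum g (\<lambda>_. undefined)"
    have override: "override_on (case_sum h (\<lambda>_. undefined)) (case_sum (\<lambda>_. undefined) p) ?J i =
        case_sum h p i" if "p \<in> {..<m} \<rightarrow>\<^sub>E UNIV" for h :: "'n \<Rightarrow> 'd" and p i
      using PiE_arb[OF that] by (cases i) (auto simp: override_on_def image_iff)
    have "(\<Sum>p\<in>{..<m} \<rightarrow>\<^sub>E UNIV. \<Prod>i\<in>?A \<union> ?J.
        word_eval x (w i) $ case_sum f p i $ case_sum g p (\<tau> i)) =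
      (\<Sum>p\<in>?J \<rightarrow>\<^sub>E UNIV. \<Prod>i\<in>?A \<union> ?J.
        word_eval x (w i) $ override_on ?f p ?J i $ override_on ?g p ?J (\<tau> i))"
    proof (rule sum.reindex_bij_witness[of _ "\<lambda>p. p \<circ> Inr" "\<lambda>p. case_sum (\<lambda>_. undefined) p"], goal_cases)
      case (1 p)
      then show ?case by (auto simp: fun_eq_iff)
    next
      case (2 p)
      then show ?case by (auto simp: PiE_def extensional_def split: sum.splits)
    next
      case (3 p)
      then show ?case using PiE_arb[OF 3] by (auto simp: fun_eq_iff image_iff split: sum.splits)
    next
      case (4 p)
      then show ?case by (auto simp: PiE_def extensional_def)
    next
      case (5 p)
      then show ?case by (simp add: override)
    qed
    also have "\<dots> = trace_monomial (N, s, M) x $ f $ g"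
      by (simp add: contract prod.reindex \<sigma>' monomial)
    finally show ?thesis .
  qed
  then show ?thesis
    unfolding AJ by blast
qed

section \<open>Equivariant multilinear maps\<close>

definition entry :: "('d::finite, 'k::finite) endo_tuple \<Rightarrow> 'k \<times> 'd \<times> 'd \<Rightarrow> rat"
  where "entry x = (\<lambda>(l, i, j). x $ l $ i $ j)"

lemma sum_PiE_triple:
  "(\<Sum>v\<in>A \<rightarrow>\<^sub>E UNIV. \<phi> v) =
    (\<Sum>l\<in>A \<rightarrow>\<^sub>E UNIV. \<Sum>p\<in>A \<rightarrow>\<^sub>E UNIV. \<Sum>q\<in>A \<rightarrow>\<^sub>E UNIV. \<phi> (\<lambda>t\<in>A. (l t, p t, q t)))"
  unfolding sum.cartesian_product
  by (rule sum.reindex_bij_witness[of _ "\<lambda>(l, p, q). \<lambda>t\<in>A. (l t, p t, q t)"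
        "\<lambda>v. (\<lambda>t\<in>A. fst (v t), \<lambda>t\<in>A. fst (snd (v t)), \<lambda>t\<in>A. snd (snd (v t)))"])
    (auto simp: fun_eq_iff PiE_def extensional_def restrict_def intro!: arg_cong[where f = \<phi>])

lemma sum_delta_PiE:
  fixes \<phi> :: "'a \<Rightarrow> 'b::finite \<Rightarrow> 'f::comm_semiring_1"
  assumes "finite A"
  shows "(\<Sum>p\<in>A \<rightarrow>\<^sub>E UNIV. \<psi> p * (\<Prod>t\<in>A. if p t = h t then \<phi> t (p t) else 0)) =
    \<psi> (restrict h A) * (\<Prod>t\<in>A. \<phi> t (h t))"
proof -
  have "(\<Prod>t\<in>A. if p t = h t then \<phi> t (p t) else 0) =
      (if p = restrict h A then \<Prod>t\<in>A. \<phi> t (h t) else 0)" if p: "p \<in> A \<rightarrow>\<^sub>E UNIV" for p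
  proof (cases "p = restrict h A")
    case False
    then obtain t where "t \<in> A" "p t \<noteq> h t"
      using PiE_eq_iff[OF p, of "restrict h A" UNIV] by auto
    then have "(\<Prod>t\<in>A. if p t = h t then \<phi> t (p t) else 0) = 0"
      using assms by (intro prod_zero) auto
    then show ?thesis using False by simp
  qed (auto intro: prod.cong)
  moreover have "finite (A \<rightarrow>\<^sub>E (UNIV :: 'b set))"
    using assms by (intro finite_PiE) auto
  ultimately show ?thesis
    by (simp add: if_distrib[of "\<lambda>c. _ * c"] cong: if_cong)
qed

lemmas sum_delta_PiE_const = sum_delta_PiE[where \<phi> = "\<lambda>t _. c t" for c]

definition single_entry :: "'k \<Rightarrow> 'd::finite endo \<Rightarrow> ('d, 'k::finite) endo_tuple"
  where "single_entry l Y = (\<chi> l'. if l' = l then Y else 0)"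

text \<open>The extra factor \<open>g\<close> cancels the inverse in the conjugation. With
  \<open>conj_tensor_mult\<close>, equivariance takes a form free of inverses, as
  \<open>schur_weyl_GL\<close> requires.\<close>

lemma conj_single_entry:
  assumes "invertible g"
  shows "conj_tuple g (single_entry l (Y ** g)) = single_entry l (g ** Y)"
proof -
  have "g ** (Y ** g) ** matrix_inv g = g ** Y"
    by (simp add: matrix_mul_assoc[symmetric] matrix_inv_right[OF assms])
  then show ?thesis
    by (simp add: conj_tuple_def single_entry_def vec_eq_iff matrix_matrix_mult_def)
qed

lemma conj_tensor_mult:
  fixes T :: "('d::finite, 'n::finite) tensor_endo"
  assumes "invertible g"
  shows "conj_tensor g T ** tensor_endo (\<lambda>_. g) = tensor_endo (\<lambda>_. g) ** T"
proof -
  have "tensor_endo (\<lambda>_. matrix_inv g) ** tensor_endo (\<lambda>_. g) = (mat 1 :: ('d, 'n) tensor_endo)"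
    by (simp add: tensor_endo_mult matrix_inv_left[OF assms] tensor_endo_one)
  then show ?thesis
    by (simp add: conj_tensor_def flip: matrix_mul_assoc)
qed

lemma word_eval_Nil_nth: "word_eval x [] $ i $ j = (if i = j then 1 else 0)"
  by (simp add: word_eval_def mat_def)

lemma word_eval_single: "word_eval x [l] = x $ l"
  by (simp add: word_eval_def)

lemma equivariant_multilinear_in_trace_polynomials:
  fixes F :: "(nat \<Rightarrow> ('d::finite, 'k::finite) endo_tuple) \<Rightarrow> ('d, 'n::finite) tensor_endo"
  assumes F: "\<And>y f g. F y $ f $ g = (\<Sum>v\<in>{..<m} \<rightarrow>\<^sub>E UNIV. K f g v * (\<Prod>t<m. entry (y t) (v t)))"
    and equi: "\<And>g y. invertible g \<Longrightarrow> F (\<lambda>t. conj_tuple g (y t)) = conj_tensor g (F y)"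
  shows "(\<lambda>x. F (\<lambda>_. x)) \<in> trace_polynomials"
proof -
  define P where "P = ({..<m} \<rightarrow>\<^sub>E (UNIV :: 'd set))"
  define L where "L = ({..<m} \<rightarrow>\<^sub>E (UNIV :: 'k set))"
  define I where "I = ((UNIV :: 'n set) <+> {..<m})"
  define K' where "K' l f g p q = K f g (\<lambda>t\<in>{..<m}. (l t, p t, q t))" for l f g p q
  have finI: "finite I" by (simp add: I_def)
  have F3: "F y $ f $ g = (\<Sum>l\<in>L. \<Sum>p\<in>P. \<Sum>q\<in>P. K' l f g p q * (\<Prod>t<m. y t $ l t $ p t $ q t))"
    for y f g
    unfolding F sum_PiE_triple L_def P_def K'_def by (simp add: entry_def)
  \<comment> \<open>Filling slot \<open>t\<close> only at the variable \<open>l t\<close> isolates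
    the coefficients that belong to the choice \<open>l\<close> of variables.\<close>
  have F_single: "F (\<lambda>t. single_entry (l t) (Y t)) $ f $ g =
      (\<Sum>p\<in>P. \<Sum>q\<in>P. K' l f g p q * (\<Prod>t<m. Y t $ p t $ q t))" if "l \<in> L" for l Y f g
  proof -
    have "F (\<lambda>t. single_entry (l t) (Y t)) $ f $ g =
        (\<Sum>l'\<in>L. \<Sum>p\<in>P. \<Sum>q\<in>P. K' l' f g p q * (\<Prod>t<m. if l' t = l t then Y t $ p t $ q t else 0))"
      by (simp add: F3 single_entry_def if_distrib[of "\<lambda>a. a $ _ $ _"] cong: if_cong)
    also have "\<dots> = (\<Sum>p\<in>P. \<Sum>q\<in>P. \<Sum>l'\<in>L.
        K' l' f g p q * (\<Prod>t<m. if l' t = l t then Y t $ p t $ q t else 0))"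
      by (subst sum.swap, intro sum.cong refl, subst sum.swap) simp
    also have "\<dots> = (\<Sum>p\<in>P. \<Sum>q\<in>P. K' (restrict l {..<m}) f g p q * (\<Prod>t<m. Y t $ p t $ q t))"
      unfolding L_def by (simp add: sum_delta_PiE_const)
    also have "restrict l {..<m} = l"
      using that by (simp add: L_def)
    finally show ?thesis .
  qed

  \<comment> \<open>Matrix units in the slots read off coefficients: a factor \<open>G\<close> on
    their left spreads over the row index \<open>p\<close>, one on their right over the column index
    \<open>q\<close>.\<close>
  define E where "E p q t = (\<chi> i j. if i = p t \<and> j = q t then 1 else (0::rat))" for p q :: "nat \<Rightarrow> 'd" and t
  have gE: "(G ** E p q t) $ i $ j = (if j = q t then G $ i $ p t else 0)" for G :: "'d endo" and p q t i j
    by (auto simp: matrix_matrix_mult_def E_def if_distrib[of "\<lambda>a. _ * a"] cong: if_cong)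
  have Eg: "(E p q t ** G) $ i $ j = (if i = p t then G $ q t $ j else 0)" for G :: "'d endo" and p q t i j
    by (auto simp: matrix_matrix_mult_def E_def if_distrib[of "\<lambda>a. a * _"] cong: if_cong)
  have F_gE: "F (\<lambda>t. single_entry (l t) (G ** E p q t)) $ f $ g =
      (\<Sum>p'\<in>P. K' l f g p' q * (\<Prod>t<m. G $ p' t $ p t))" if "l \<in> L" "q \<in> P" for l p q f g G
  proof -
    have "restrict q {..<m} = q" using that by (simp add: P_def)
    then show ?thesis
      unfolding F_single[OF that(1)] gE P_def by (simp add: sum_delta_PiE_const)
  qed
  have F_Eg: "F (\<lambda>t. single_entry (l t) (E p q t ** G)) $ f $ g =
      (\<Sum>q'\<in>P. K' l f g p q' * (\<Prod>t<m. G $ q t $ q' t))" if "l \<in> L" "p \<in> P" for l p q f g G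
  proof -
    have "restrict p {..<m} = p" using that by (simp add: P_def)
    then show ?thesis
      unfolding F_single[OF that(1)] Eg P_def by (subst sum.swap) (simp add: sum_delta_PiE_const)
  qed

  \<comment> \<open>The slots are arguments, hence dual to the output factors: their column indices
    \<open>q\<close> join the row index \<open>f\<close> in \<open>a\<close>, and their row indices
    \<open>p\<close> join the column index \<open>g\<close> in \<open>b\<close>. With this crossing
    the coefficients form an operator that commutes with tensor powers of \<open>G\<close>.\<close>
  have "\<forall>l\<in>L. \<exists>k. \<forall>a\<in>I \<rightarrow>\<^sub>E UNIV. \<forall>b\<in>I \<rightarrow>\<^sub>E UNIV.
      K' l (a \<circ> Inl) (b \<circ> Inl) (b \<circ> Inr) (a \<circ> Inr) =
      (\<Sum>\<tau> | \<tau> permutes I. k \<tau> * (if a = b \<circ> \<tau> then 1 else 0))"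
  proof (intro ballI schur_weyl_GL[OF finI])
    fix l and G :: "'d endo" and a b :: "'n + nat \<Rightarrow> 'd"
    assume l: "l \<in> L" and G: "invertible G" and "a \<in> I \<rightarrow>\<^sub>E UNIV" "b \<in> I \<rightarrow>\<^sub>E UNIV"
    then obtain f q g p where a: "a = case_sum f q" "q \<in> P" and b: "b = case_sum g p" "p \<in> P"
      unfolding I_def P_def by (metis PiE_Plus_cases)
    have "F (\<lambda>t. single_entry (l t) (G ** E p q t)) ** tensor_endo (\<lambda>_. G) =
        tensor_endo (\<lambda>_. G) ** F (\<lambda>t. single_entry (l t) (E p q t ** G))"
      using equi[OF G, of "\<lambda>t. single_entry (l t) (E p q t ** G)"]
      by (simp add: conj_single_entry[OF G] conj_tensor_mult[OF G])
    then have "(F (\<lambda>t. single_entry (l t) (G ** E p q t)) ** tensor_endo (\<lambda>_. G)) $ f $ g =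
        (tensor_endo (\<lambda>_. G) ** F (\<lambda>t. single_entry (l t) (E p q t ** G))) $ f $ g"
      by simp
    then have "(\<Sum>h\<in>UNIV. (\<Sum>p'\<in>P. K' l f h p' q * (\<Prod>t<m. G $ p' t $ p t)) * (\<Prod>i\<in>UNIV. G $ h i $ g i)) =
        (\<Sum>h\<in>UNIV. (\<Prod>i\<in>UNIV. G $ f i $ h i) * (\<Sum>q'\<in>P. K' l h g p q' * (\<Prod>t<m. G $ q t $ q' t)))"
      by (simp only: matrix_mult_nth F_gE[OF l a(2)] F_Eg[OF l b(2)] tensor_endo_def vec_lambda_beta)
    then have "(\<Sum>h\<in>UNIV. \<Sum>p'\<in>P. K' l f h p' q * ((\<Prod>i\<in>UNIV. G $ h i $ g i) * (\<Prod>t<m. G $ p' t $ p t))) =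
        (\<Sum>h\<in>UNIV. \<Sum>q'\<in>P. ((\<Prod>i\<in>UNIV. G $ f i $ h i) * (\<Prod>t<m. G $ q t $ q' t)) * K' l h g p q')"
      by (simp only: sum_distrib_left sum_distrib_right mult_ac)
    then show "(\<Sum>c\<in>I \<rightarrow>\<^sub>E UNIV. K' l (a \<circ> Inl) (c \<circ> Inl) (c \<circ> Inr) (a \<circ> Inr) * (\<Prod>i\<in>I. G $ c i $ b i)) =
        (\<Sum>c\<in>I \<rightarrow>\<^sub>E UNIV. (\<Prod>i\<in>I. G $ a i $ c i) * K' l (c \<circ> Inl) (b \<circ> Inl) (b \<circ> Inr) (c \<circ> Inr))"
      by (simp add: a b I_def sum_PiE_Plus prod.Plus o_def flip: P_def)
  qed
  then obtain k where k: "\<And>l a b. l \<in> L \<Longrightarrow> a \<in> I \<rightarrow>\<^sub>E UNIV \<Longrightarrow> b \<in> I \<rightarrow>\<^sub>E UNIV \<Longrightarrow>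
      K' l (a \<circ> Inl) (b \<circ> Inl) (b \<circ> Inr) (a \<circ> Inr) =
      (\<Sum>\<tau> | \<tau> permutes I. k l \<tau> * (if a = b \<circ> \<tau> then 1 else 0))"
    unfolding bchoice_iff by blast

  \<comment> \<open>A slot carries its variable; a tensor factor carries the empty word, whose
    identity matrix supplies a Kronecker delta.\<close>
  define w :: "(nat \<Rightarrow> 'k) \<Rightarrow> 'n + nat \<Rightarrow> 'k list" where
    "w l = case_sum (\<lambda>_. []) (\<lambda>t. [l t])" for l
  define T where "T l \<tau> = (SOME t. \<forall>(x :: ('d, 'k) endo_tuple) f g.
      (\<Sum>p\<in>P. \<Prod>i\<in>I. word_eval x (w l i) $ case_sum f p i $ case_sum g p (\<tau> i)) =
      trace_monomial t x $ f $ g)" for l \<tau>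
  have T: "(\<Sum>p\<in>P. \<Prod>i\<in>I. word_eval x (w l i) $ case_sum f p i $ case_sum g p (\<tau> i)) =
      trace_monomial (T l \<tau>) x $ f $ g" if "\<tau> permutes I" for l \<tau> and x :: "('d, 'k) endo_tuple" and f g
    unfolding T_def I_def P_def
    by (rule someI_ex[OF contraction_eq_trace_monomial[OF that[unfolded I_def], of "w l", where 'd = 'd],
          THEN spec, THEN spec, THEN spec])

  have contract: "(\<Sum>p\<in>P. \<Sum>q\<in>P. (if case_sum f q = case_sum g p \<circ> \<tau> then 1 else 0) *
      (\<Prod>t<m. x $ l t $ p t $ q t)) = trace_monomial (T l \<tau>) x $ f $ g"
    if \<tau>: "\<tau> permutes I" for l \<tau> f g and x :: "('d, 'k) endo_tuple"
  proof -
    have "(\<Sum>q\<in>P. (if case_sum f q = case_sum g p \<circ> \<tau> then 1 else 0) * (\<Prod>t<m. x $ l t $ p t $ q t)) =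
        (\<Prod>i\<in>I. word_eval x (w l i) $ case_sum f p i $ case_sum g p (\<tau> i))" if p: "p \<in> P" for p
    proof -
      \<comment> \<open>The condition on \<open>\<tau>\<close> determines \<open>q\<close> from
        \<open>p\<close>: \<open>h\<close> is its only admissible value on the slots. What remains
        concerns the \<open>Inl\<close> nodes and becomes entries of identity matrices.\<close>
      define h where "h t = case_sum g p (\<tau> (Inr t))" for t
      have "(if case_sum f q = case_sum g p \<circ> \<tau> then 1 else 0) =
          (\<Prod>i\<in>UNIV. if f i = case_sum g p (\<tau> (Inl i)) then 1 else 0) *
          (\<Prod>t<m. if q t = h t then 1 else (0::rat))" if q: "q \<in> P" for q
      proof -
        have *: "case_sum f q \<in> I \<rightarrow>\<^sub>E UNIV" "case_sum g p \<circ> \<tau> \<in> I \<rightarrow>\<^sub>E UNIV"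
          using case_sum_in_PiE_Plus[OF q[unfolded P_def], of f]
            comp_permutes_in_PiE[OF case_sum_in_PiE_Plus[OF p[unfolded P_def], of g] \<tau>[unfolded I_def]]
          by (simp_all only: I_def)
        have "case_sum f q = case_sum g p \<circ> \<tau> \<longleftrightarrow>
            (\<forall>i. f i = case_sum g p (\<tau> (Inl i))) \<and> (\<forall>t\<in>{..<m}. q t = h t)"
          unfolding PiE_eq_iff[OF *] by (simp add: I_def h_def Plus_def ball_Un)
        then show ?thesis
          by (simp add: prod_indicator)
      qed
      then have "(\<Sum>q\<in>P. (if case_sum f q = case_sum g p \<circ> \<tau> then 1 else 0) * (\<Prod>t<m. x $ l t $ p t $ q t)) =
          (\<Sum>q\<in>P. (\<Prod>i\<in>UNIV. if f i = case_sum g p (\<tau> (Inl i)) then 1 else 0) *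
            (\<Prod>t<m. if q t = h t then x $ l t $ p t $ q t else 0))"
        by (intro sum.cong refl)
          (simp add: mult.assoc flip: prod.distrib, simp add: if_distrib[of "\<lambda>a. a * _"] cong: if_cong)
      also have "\<dots> = (\<Prod>i\<in>UNIV. if f i = case_sum g p (\<tau> (Inl i)) then 1 else 0) *
          (\<Prod>t<m. x $ l t $ p t $ h t)"
        unfolding P_def
        by (rule sum_delta_PiE[where \<phi> = "\<lambda>t j. x $ l t $ p t $ j"]) simp
      also have "\<dots> = (\<Prod>i\<in>I. word_eval x (w l i) $ case_sum f p i $ case_sum g p (\<tau> i))"
        by (simp add: I_def prod.Plus w_def word_eval_Nil_nth word_eval_single h_def)
      finally show ?thesis .
    qed
    then show ?thesis
      using T[OF \<tau>, of x l f g] by simp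
  qed

  have "F (\<lambda>_. x) = (\<Sum>l\<in>L. \<Sum>\<tau> | \<tau> permutes I. k l \<tau> *m trace_monomial (T l \<tau>) x)" for x
  proof -
    have "F (\<lambda>_. x) $ f $ g = (\<Sum>l\<in>L. \<Sum>\<tau> | \<tau> permutes I. k l \<tau> * trace_monomial (T l \<tau>) x $ f $ g)" for f g
    proof -
      have "F (\<lambda>_. x) $ f $ g = (\<Sum>l\<in>L. \<Sum>p\<in>P. \<Sum>q\<in>P. \<Sum>\<tau> | \<tau> permutes I.
          k l \<tau> * ((if case_sum f q = case_sum g p \<circ> \<tau> then 1 else 0) * (\<Prod>t<m. x $ l t $ p t $ q t)))"
        unfolding F3
      proof (intro sum.cong refl)
        fix l p q assume *: "l \<in> L" "p \<in> P" "q \<in> P"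
        have "K' l f g p q = (\<Sum>\<tau> | \<tau> permutes I. k l \<tau> * (if case_sum f q = case_sum g p \<circ> \<tau> then 1 else 0))"
          using k[OF *(1), of "case_sum f q" "case_sum g p"]
            case_sum_in_PiE_Plus[OF *(2)[unfolded P_def], of g]
            case_sum_in_PiE_Plus[OF *(3)[unfolded P_def], of f]
          by (simp add: I_def o_def)
        then show "K' l f g p q * (\<Prod>t<m. x $ l t $ p t $ q t) = (\<Sum>\<tau> | \<tau> permutes I.
            k l \<tau> * ((if case_sum f q = case_sum g p \<circ> \<tau> then 1 else 0) * (\<Prod>t<m. x $ l t $ p t $ q t)))"
          by (simp only: sum_distrib_right mult.assoc)
      qed
      also have "\<dots> = (\<Sum>l\<in>L. \<Sum>\<tau> | \<tau> permutes I. \<Sum>p\<in>P. \<Sum>q\<in>P.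
          k l \<tau> * ((if case_sum f q = case_sum g p \<circ> \<tau> then 1 else 0) * (\<Prod>t<m. x $ l t $ p t $ q t)))"
        by (intro sum.cong refl, subst (2) sum.swap, subst sum.swap, rule refl)
      also have "\<dots> = (\<Sum>l\<in>L. \<Sum>\<tau> | \<tau> permutes I. k l \<tau> * trace_monomial (T l \<tau>) x $ f $ g)"
        by (intro sum.cong refl) (simp add: contract flip: sum_distrib_left)
      finally show ?thesis .
    qed
    then show ?thesis
      by (simp add: vec_eq_iff)
  qed
  then show ?thesis
    by (simp only:)
      (intro trace_polynomials_sum trace_polynomials_smult trace_polynomials_monomial)
qed

section \<open>Reduction to multilinear maps\<close>

text \<open>Commutative monomials are represented redundantly by words: coefficients are not unique,
  but products become concatenation and the factors have positions that polarization can
  permute.\<close>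

definition monomial_eval :: "('d::finite, 'k::finite) endo_tuple \<Rightarrow> ('k \<times> 'd \<times> 'd) list \<Rightarrow> rat"
  where "monomial_eval x w = (\<Prod>v\<leftarrow>w. entry x v)"

text \<open>The bound is strict so that \<open>degree_less 0\<close> forces the zero function, which
  is the base of the induction on the degree.\<close>

definition degree_less :: "nat \<Rightarrow> (('d::finite, 'k::finite) endo_tuple \<Rightarrow> rat) \<Rightarrow> bool"
  where "degree_less m p \<longleftrightarrow> (\<exists>C. \<forall>x. p x = (\<Sum>w | length w < m. C w * monomial_eval x w))"

lemma finite_lists_length_less: "finite {w :: 'a::finite list. length w < m}"
  by (rule finite_subset[OF _ finite_lists_length_le[of UNIV m]]) auto

lemma finite_lists_length: "finite {w :: 'a::finite list. length w = m}"
  by (rule finite_subset[OF _ finite_lists_length_less[of "Suc m"]]) auto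

lemma degree_lessI:
  "(\<And>x. p x = (\<Sum>w | length w < m. C w * monomial_eval x w)) \<Longrightarrow> degree_less m p"
  unfolding degree_less_def by blast

lemma degree_less_mono:
  assumes "degree_less m p" "m \<le> n"
  shows "degree_less n p"
proof -
  obtain C where C: "\<And>x. p x = (\<Sum>w | length w < m. C w * monomial_eval x w)"
    using assms by (auto simp: degree_less_def)
  have "p x = (\<Sum>w | length w < n. (if length w < m then C w else 0) * monomial_eval x w)" for x
    unfolding C
    by (rule sum.mono_neutral_cong_left) (use assms(2) in \<open>auto simp: finite_lists_length_less\<close>)
  then show ?thesis by (rule degree_lessI)
qed

lemma degree_less_add:
  assumes "degree_less m p" "degree_less m q"
  shows "degree_less m (\<lambda>x. p x + q x)"
proof -
  obtain C D where "\<And>x. p x = (\<Sum>w | length w < m. C w * monomial_eval x w)"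
    "\<And>x. q x = (\<Sum>w | length w < m. D w * monomial_eval x w)"
    using assms unfolding degree_less_def by blast
  then show ?thesis
    by (intro degree_lessI[where C = "\<lambda>w. C w + D w"]) (simp add: sum.distrib distrib_right)
qed

lemma degree_less_mult:
  assumes "degree_less m p" "degree_less n q"
  shows "degree_less (m + n) (\<lambda>x. p x * q x)"
proof -
  obtain C D where C: "\<And>x. p x = (\<Sum>w | length w < m. C w * monomial_eval x w)"
    and D: "\<And>x. q x = (\<Sum>w | length w < n. D w * monomial_eval x w)"
    using assms unfolding degree_less_def by blast
  define U where "U = {u :: ('b \<times> 'a \<times> 'a) list. length u < m} \<times> {v :: ('b \<times> 'a \<times> 'a) list. length v < n}"
  have "p x * q x = (\<Sum>w | length w < m + n.
      (\<Sum>uv | uv \<in> U \<and> fst uv @ snd uv = w. C (fst uv) * D (snd uv)) * monomial_eval x w)" for x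
  proof -
    have "p x * q x = (\<Sum>uv\<in>U. C (fst uv) * D (snd uv) * monomial_eval x (fst uv @ snd uv))"
      by (simp add: C D U_def sum_product sum.cartesian_product monomial_eval_def case_prod_unfold mult_ac)
    also have "\<dots> = (\<Sum>w | length w < m + n. \<Sum>uv | uv \<in> U \<and> fst uv @ snd uv = w.
        C (fst uv) * D (snd uv) * monomial_eval x (fst uv @ snd uv))"
      by (rule sum.group[symmetric]) (auto simp: U_def finite_lists_length_less)
    finally show ?thesis
      by (simp add: sum_distrib_right)
  qed
  then show ?thesis by (rule degree_lessI)
qed

lemma polynomial_fun_degree_less:
  assumes "polynomial_fun p"
  shows "\<exists>m. degree_less m p"
  using assms
proof induction
  case (const c)
  have "degree_less 1 (\<lambda>x. c)"
    by (rule degree_lessI[where C = "\<lambda>_. c"]) (simp add: monomial_eval_def)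
  then show ?case by blast
next
  case (coord l i j)
  have "degree_less 2 (\<lambda>x. x $ l $ i $ j)"
    by (rule degree_lessI[where C = "\<lambda>w. if w = [(l, i, j)] then 1 else 0"])
      (simp add: monomial_eval_def entry_def finite_lists_length_less
        if_distrib[of "\<lambda>c. c * _"] cong: if_cong)
  then show ?case by blast
next
  case (add p q)
  then obtain m n where "degree_less m p" "degree_less n q" by blast
  then have "degree_less (max m n) (\<lambda>x. p x + q x)"
    by (intro degree_less_add) (auto intro: degree_less_mono)
  then show ?case by blast
next
  case (mult p q)
  then show ?case using degree_less_mult by blast
qed

text \<open>The inclusion-exclusion form uses only values of \<open>H\<close> at sums of the
  \<open>y t\<close>, so no coefficients have to be chosen and equivariance is inherited.\<close>

definition polarize ::
    "nat \<Rightarrow> (('d::finite, 'k::finite) endo_tuple \<Rightarrow> ('d, 'n::finite) tensor_endo) \<Rightarrow>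
      (nat \<Rightarrow> ('d, 'k) endo_tuple) \<Rightarrow> ('d, 'n) tensor_endo"
  where "polarize m H y = (\<Sum>S\<in>Pow {..<m}. (-1) ^ card ({..<m} - S) *m H (\<Sum>t\<in>S. y t))"

lemma entry_sum: "entry (\<Sum>t\<in>S. y t) v = (\<Sum>t\<in>S. entry (y t) v)"
  by (simp add: entry_def case_prod_unfold)

lemma monomial_eval_nth: "monomial_eval x w = (\<Prod>s<length w. entry x (w ! s))"
  by (simp add: monomial_eval_def prod.list_conv_set_nth atLeast0LessThan)

text \<open>\<open>polarization_small\<close> discards the words shorter than \<open>m\<close>, and
  \<open>polarization_permutes\<close> evaluates those of length exactly \<open>m\<close>.\<close>

lemma polarize_nth:
  assumes C: "\<And>x. H x $ f $ g = (\<Sum>w | length w < Suc m. C w * monomial_eval x w)"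
  shows "polarize m H y $ f $ g =
    (\<Sum>w | length w = m. C w * (\<Sum>\<pi> | \<pi> permutes {..<m}. \<Prod>s<m. entry (y (\<pi> s)) (w ! s)))"
proof -
  have "polarize m H y $ f $ g = (\<Sum>w | length w < Suc m. C w *
      (\<Sum>S\<in>Pow {..<m}. (-1) ^ card ({..<m} - S) * (\<Prod>s<length w. \<Sum>t\<in>S. entry (y t) (w ! s))))"
    unfolding polarize_def sum_component smult_mat_nth C monomial_eval_nth entry_sum sum_distrib_left
    by (subst sum.swap) (simp add: mult_ac)
  also have "\<dots> = (\<Sum>w | length w = m. C w *
      (\<Sum>S\<in>Pow {..<m}. (-1) ^ card ({..<m} - S) * (\<Prod>s<length w. \<Sum>t\<in>S. entry (y t) (w ! s))))"
    by (rule sum.mono_neutral_right)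
      (auto simp: finite_lists_length_less finite_lists_length polarization_small less_Suc_eq)
  also have "\<dots> = (\<Sum>w | length w = m. C w *
      (\<Sum>\<pi> | \<pi> permutes {..<m}. \<Prod>s<m. entry (y (\<pi> s)) (w ! s)))"
    by (intro sum.cong refl) (auto simp: polarization_permutes)
  finally show ?thesis .
qed

lemma polarize_multilinear:
  assumes C: "\<And>x. H x $ f $ g = (\<Sum>w | length w < Suc m. C w * monomial_eval x w)"
  shows "\<exists>K. \<forall>y. polarize m H y $ f $ g =
    (\<Sum>v\<in>{..<m} \<rightarrow>\<^sub>E UNIV. K v * (\<Prod>t<m. entry (y t) (v t)))"
proof -
  \<comment> \<open>Here the letter \<open>w ! s\<close> goes to slot \<open>\<pi> s\<close>; the
    coefficient \<open>K v\<close> collects all pairs of a word and a permutation that fill the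
    slots as \<open>v\<close> does.\<close>
  define h where "h w \<pi> = (\<lambda>t\<in>{..<m}. w ! inv \<pi> t)" for w :: "('b \<times> 'a \<times> 'a) list" and \<pi>
  define K where "K v = (\<Sum>w | length w = m. \<Sum>\<pi> | \<pi> permutes {..<m}.
    C w * (if v = h w \<pi> then 1 else 0))" for v
  have fin: "finite ({..<m} \<rightarrow>\<^sub>E (UNIV :: ('b \<times> 'a \<times> 'a) set))"
    by (intro finite_PiE) auto
  have "polarize m H y $ f $ g = (\<Sum>v\<in>{..<m} \<rightarrow>\<^sub>E UNIV. K v * (\<Prod>t<m. entry (y t) (v t)))" for y
  proof -
    have reindex: "(\<Prod>s<m. entry (y (\<pi> s)) (w ! s)) = (\<Prod>t<m. entry (y t) (h w \<pi> t))"
      if "\<pi> permutes {..<m}" for \<pi> and w :: "('b \<times> 'a \<times> 'a) list"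
    proof -
      have "(\<Prod>t<m. entry (y t) (h w \<pi> t)) = (\<Prod>t<m. entry (y t) (w ! inv \<pi> t))"
        by (simp add: h_def)
      also have "\<dots> = (\<Prod>s<m. entry (y (\<pi> s)) (w ! s))"
        by (subst prod.permute[OF that]) (simp add: o_def permutes_inverses[OF that])
      finally show ?thesis by simp
    qed
    have "(\<Sum>v\<in>{..<m} \<rightarrow>\<^sub>E UNIV. K v * (\<Prod>t<m. entry (y t) (v t))) =
        (\<Sum>v\<in>{..<m} \<rightarrow>\<^sub>E UNIV. \<Sum>w | length w = m. \<Sum>\<pi> | \<pi> permutes {..<m}.
          if v = h w \<pi> then C w * (\<Prod>t<m. entry (y t) (v t)) else 0)"
      unfolding K_def sum_distrib_right by (intro sum.cong refl) simp
    also have "\<dots> = (\<Sum>w | length w = m. \<Sum>v\<in>{..<m} \<rightarrow>\<^sub>E UNIV. \<Sum>\<pi> | \<pi> permutes {..<m}.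
          if v = h w \<pi> then C w * (\<Prod>t<m. entry (y t) (v t)) else 0)"
      by (rule sum.swap)
    also have "\<dots> = (\<Sum>w | length w = m. \<Sum>\<pi> | \<pi> permutes {..<m}. \<Sum>v\<in>{..<m} \<rightarrow>\<^sub>E UNIV.
          if v = h w \<pi> then C w * (\<Prod>t<m. entry (y t) (v t)) else 0)"
      by (intro sum.cong refl sum.swap)
    also have "\<dots> = polarize m H y $ f $ g"
      unfolding polarize_nth[OF C] sum_distrib_left
      by (intro sum.cong refl) (use fin in \<open>auto simp: sum.delta reindex h_def\<close>)
    finally show ?thesis by simp
  qed
  then show ?thesis by blast
qed

lemma polarize_diagonal:
  assumes C: "\<And>x. H x $ f $ g = (\<Sum>w | length w < Suc m. C w * monomial_eval x w)"
  shows "polarize m H (\<lambda>_. x) $ f $ g = fact m * (\<Sum>w | length w = m. C w * monomial_eval x w)"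
  unfolding polarize_nth[OF C] sum_distrib_left
  by (intro sum.cong refl) (auto simp: monomial_eval_nth card_permutations)

lemma matrix_mult_sum_left:
  "(\<Sum>a\<in>A. f a) ** T = (\<Sum>a\<in>A. (f a :: rat ^ 'p::finite ^ 'q::finite) ** T)"
  using matrix_mult_sum_sum[of f A "\<lambda>_. T" "{()}"] by simp

lemma matrix_mult_sum_right:
  "T ** (\<Sum>a\<in>A. f a) = (\<Sum>a\<in>A. (T :: rat ^ 'p::finite ^ 'q::finite) ** f a)"
  using matrix_mult_sum_sum[of "\<lambda>_. T" "{()}" f A] by simp

lemma conj_tensor_sum: "conj_tensor g (\<Sum>a\<in>A. T a) = (\<Sum>a\<in>A. conj_tensor g (T a))"
  by (simp add: conj_tensor_def matrix_mult_sum_left matrix_mult_sum_right)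

lemma conj_tensor_add: "conj_tensor g (A + B) = conj_tensor g A + conj_tensor g B"
  using conj_tensor_sum[of g "\<lambda>b. if b then A else B" UNIV] by (simp add: UNIV_bool add.commute)

lemma conj_tensor_smult: "conj_tensor g (c *m T) = c *m conj_tensor g T"
  using smult_mat_mult[of 1 "tensor_endo (\<lambda>_. g)" c T]
    smult_mat_mult[of c "tensor_endo (\<lambda>_. g) ** T" 1 "tensor_endo (\<lambda>_. matrix_inv g)"]
  by (simp add: conj_tensor_def)

lemma conj_tuple_sum: "conj_tuple g (\<Sum>t\<in>S. y t) = (\<Sum>t\<in>S. conj_tuple g (y t))"
  by (simp add: conj_tuple_def vec_eq_iff matrix_mult_sum_left matrix_mult_sum_right)

lemma polarize_equivariant:
  assumes "equivariant H" "invertible g"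
  shows "polarize m H (\<lambda>t. conj_tuple g (y t)) = conj_tensor g (polarize m H y)"
  using assms
  by (simp add: polarize_def equivariant_def conj_tensor_sum conj_tensor_smult flip: conj_tuple_sum)

lemma equivariant_in_trace_polynomials:
  fixes H :: "('d::finite, 'k::finite) endo_tuple \<Rightarrow> ('d, 'n::finite) tensor_endo"
  assumes "\<And>f g. degree_less m (\<lambda>x. H x $ f $ g)" "equivariant H"
  shows "H \<in> trace_polynomials"
  using assms
proof (induction m arbitrary: H)
  case 0
  then have "H = (\<lambda>x. 0)"
    by (auto simp: degree_less_def fun_eq_iff vec_eq_iff)
  then show ?case by (simp add: trace_polynomials_zero)
next
  case (Suc m)
  have "\<forall>f g. \<exists>C. \<forall>x. H x $ f $ g = (\<Sum>w | length w < Suc m. C w * monomial_eval x w)"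
    using Suc.prems(1) by (simp add: degree_less_def)
  then obtain C where C: "\<And>f g x. H x $ f $ g = (\<Sum>w | length w < Suc m. C f g w * monomial_eval x w)"
    unfolding choice_iff by blast
  have "\<forall>f g. \<exists>K. \<forall>y. polarize m H y $ f $ g =
      (\<Sum>v\<in>{..<m} \<rightarrow>\<^sub>E UNIV. K v * (\<Prod>t<m. entry (y t) (v t)))"
    using polarize_multilinear[OF C] by blast
  then obtain K where "\<And>f g y. polarize m H y $ f $ g =
      (\<Sum>v\<in>{..<m} \<rightarrow>\<^sub>E UNIV. K f g v * (\<Prod>t<m. entry (y t) (v t)))"
    unfolding choice_iff by blast
  then have top: "(\<lambda>x. polarize m H (\<lambda>_. x)) \<in> trace_polynomials"
    by (rule equivariant_multilinear_in_trace_polynomials) (rule polarize_equivariant[OF Suc.prems(2)])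
  \<comment> \<open>By \<open>polarize_diagonal\<close> the correction cancels exactly the words of
    length \<open>m\<close>; dividing by \<open>fact m\<close> uses characteristic zero.\<close>
  define G where "G x = H x + (- (1 / fact m)) *m polarize m H (\<lambda>_. x)" for x
  have "G \<in> trace_polynomials"
  proof (rule Suc.IH)
    fix f g
    have "{w :: ('k \<times> 'd \<times> 'd) list. length w < Suc m} = {w. length w < m} \<union> {w. length w = m}"
      by auto
    then have "H x $ f $ g = (\<Sum>w | length w < m. C f g w * monomial_eval x w) +
        (\<Sum>w | length w = m. C f g w * monomial_eval x w)" for x
      unfolding C by (subst sum.union_disjoint[symmetric]) (auto simp: finite_lists_length_less finite_lists_length)
    then have "G x $ f $ g = (\<Sum>w | length w < m. C f g w * monomial_eval x w)" for x
      by (simp add: G_def polarize_diagonal[OF C])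
    then show "degree_less m (\<lambda>x. G x $ f $ g)"
      by (rule degree_lessI)
  next
    show "equivariant G"
      using Suc.prems(2) polarize_equivariant[OF Suc.prems(2)]
      by (simp add: equivariant_def G_def conj_tensor_add conj_tensor_smult)
  qed
  then have "(\<lambda>x. G x + (1 / fact m) *m polarize m H (\<lambda>_. x)) \<in> trace_polynomials"
    using trace_polynomials_smult[OF top] by (rule trace_polynomials_add)
  also have "(\<lambda>x. G x + (1 / fact m) *m polarize m H (\<lambda>_. x)) = H"
    by (simp add: G_def fun_eq_iff vec_eq_iff)
  finally show ?case .
qed

lemma equivariant_polynomial_in_trace_polynomials:
  fixes H :: "('d::finite, 'k::finite) endo_tuple \<Rightarrow> ('d, 'n::finite) tensor_endo"
  assumes "polynomial_map H" "equivariant H"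
  shows "H \<in> trace_polynomials"
proof -
  have "\<forall>fg. \<exists>m. degree_less m (\<lambda>x. H x $ fst fg $ snd fg)"
    using assms(1) polynomial_fun_degree_less by (auto simp: polynomial_map_def)
  then obtain m where m: "\<And>fg. degree_less (m fg) (\<lambda>x. H x $ fst fg $ snd fg)"
    unfolding choice_iff by blast
  \<comment> \<open>There are finitely many matrix entries, so their degree bounds have a
    maximum.\<close>
  have "degree_less (Max (range m)) (\<lambda>x. H x $ f $ g)" for f g
    using degree_less_mono[OF m[of "(f, g)"], of "Max (range m)"] by simp
  then show ?thesis
    using assms(2) by (rule equivariant_in_trace_polynomials)
qed

section \<open>The image of the symbolic algebra\<close>

lemma polynomial_fun_sum:
  assumes "\<And>a. a \<in> A \<Longrightarrow> polynomial_fun (p a)"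
  shows "polynomial_fun (\<lambda>x. \<Sum>a\<in>A. p a x)"
  using assms
  by (induction A rule: infinite_finite_induct) (simp_all add: polynomial_fun.intros)

lemma polynomial_fun_prod:
  assumes "\<And>a. a \<in> A \<Longrightarrow> polynomial_fun (p a)"
  shows "polynomial_fun (\<lambda>x. \<Prod>a\<in>A. p a x)"
  using assms
  by (induction A rule: infinite_finite_induct) (simp_all add: polynomial_fun.intros)

lemma word_eval_Cons: "word_eval x (l # w) = x $ l ** word_eval x w"
  by (simp add: word_eval_def)

lemma polynomial_fun_word_eval: "polynomial_fun (\<lambda>x. word_eval x w $ i $ j)"
  by (induction w arbitrary: i j)
    (simp_all add: word_eval_Nil_nth word_eval_Cons matrix_mult_nth
      polynomial_fun_sum polynomial_fun.intros)

lemma polynomial_fun_trace_ring_eval: "polynomial_fun (\<lambda>x. trace_ring_eval x r)"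
proof -
  have cyclic: "polynomial_fun (\<lambda>x. cyclic_trace x c)" for c
    by (induction c rule: cyclic_word.abs_induct)
      (simp add: cyclic_trace.abs_eq trace_def polynomial_fun_sum polynomial_fun_word_eval)
  have "polynomial_fun (\<lambda>x. \<Prod>c\<in>#t. cyclic_trace x c)" for t
    by (induction t) (simp_all add: cyclic polynomial_fun.intros)
  then show ?thesis
    unfolding trace_ring_eval_def
    by (intro polynomial_fun_sum polynomial_fun.mult polynomial_fun.const)
qed

lemma polynomial_map_symb_eval: "polynomial_map (symb_eval s)"
  unfolding polynomial_map_def symb_eval_def tensor_word_eval_def
  by (auto simp: matrix_mult_nth tensor_endo_def intro!: polynomial_fun_sum polynomial_fun_prod
      polynomial_fun.mult polynomial_fun.const polynomial_fun_trace_ring_eval polynomial_fun_word_eval)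

lemma word_eval_conj_tuple:
  assumes "invertible g"
  shows "word_eval (conj_tuple g x) w = g ** word_eval x w ** matrix_inv g"
proof (induction w)
  case Nil
  then show ?case by (simp add: word_eval_def matrix_inv_right[OF assms])
next
  case (Cons l w)
  have "(g ** x $ l ** matrix_inv g) ** (g ** word_eval x w ** matrix_inv g) =
      g ** x $ l ** (matrix_inv g ** g) ** word_eval x w ** matrix_inv g"
    by (simp only: matrix_mul_assoc)
  moreover have "conj_tuple g x $ l = g ** x $ l ** matrix_inv g"
    by (simp add: conj_tuple_def)
  ultimately show ?case
    by (simp add: word_eval_Cons Cons.IH matrix_inv_left[OF assms] matrix_mul_assoc)
qed

lemma trace_ring_eval_conj_tuple:
  assumes "invertible g"
  shows "trace_ring_eval (conj_tuple g x) r = trace_ring_eval x r"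
proof -
  have "cyclic_trace (conj_tuple g x) c = cyclic_trace x c" for c
  proof (induction c rule: cyclic_word.abs_induct)
    case (1 w)
    have "trace (word_eval (conj_tuple g x) w) = trace (matrix_inv g ** (g ** word_eval x w))"
      unfolding word_eval_conj_tuple[OF assms] by (rule trace_mul_sym)
    then show ?case
      by (simp add: cyclic_trace.abs_eq matrix_mul_assoc matrix_inv_left[OF assms])
  qed
  then show ?thesis by (simp add: trace_ring_eval_def)
qed

lemma tensor_word_eval_conj_tuple:
  fixes g :: "'d::finite endo" and b :: "('k::finite, 'n::finite) tensor_word"
  assumes "invertible g"
  shows "tensor_word_eval (conj_tuple g x) b = conj_tensor g (tensor_word_eval x b)"
proof -
  \<comment> \<open>Permuting equal tensor factors changes nothing, so the inverse factors left by
    conjugating the words can be moved past the permutation.\<close>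
  have "tensor_endo (\<lambda>_. h) ** perm_endo \<sigma> = perm_endo \<sigma> ** tensor_endo (\<lambda>_. h)"
    for h :: "'d endo" and \<sigma> :: "'n perm"
    by (simp add: perm_endo_tensor_endo)
  then show ?thesis
    by (simp add: tensor_word_eval_def conj_tensor_def word_eval_conj_tuple[OF assms]
        flip: tensor_endo_mult matrix_mul_assoc)
qed

lemma symb_eval_in_equivariant_maps: "symb_eval s \<in> equivariant_maps"
  by (simp add: equivariant_maps_def polynomial_map_symb_eval equivariant_def symb_eval_def
      conj_tensor_sum conj_tensor_smult trace_ring_eval_conj_tuple tensor_word_eval_conj_tuple)

lemma trace_monomial_symb_eval:
  fixes t :: "'k::finite list list \<times> 'n::finite perm \<times> ('n \<Rightarrow> 'k list)"
  shows "\<exists>s. \<forall>x :: ('d::finite, 'k) endo_tuple. symb_eval s x = c *m trace_monomial t x"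
proof -
  obtain N \<sigma> M where t: "t = (N, \<sigma>, M)" by (cases t)
  \<comment> \<open>Basis elements of the symbolic algebra have the permutation on the right, trace
    monomials on the left. Taking a product in the latter order leaves the exchange to the
    multiplicativity of \<open>symb_eval\<close>.\<close>
  define s where "s = symb_coeff (Poly_Mapping.single (mset (map abs_cyclic_word N)) c) *
    (symb_perm (inverse \<sigma>) * symb_words M)"
  have "(\<Prod>c\<in>#mset (map abs_cyclic_word N). cyclic_trace x c) = (\<Prod>w\<leftarrow>N. trace (word_eval x w))"
    for x :: "('d, 'k) endo_tuple"
    by (induction N) (simp_all add: cyclic_trace.abs_eq)
  moreover have "(r *m mat 1) ** A = r *m A" for r and A :: "('d, 'n) tensor_endo"
    using smult_mat_mult[of r "mat 1" 1 A] by simp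
  ultimately have "symb_eval s x = c *m trace_monomial t x"
    for x :: "('d, 'k) endo_tuple"
    by (simp add: s_def t symb_eval_mult symb_eval_coeff symb_eval_perm symb_eval_words
        trace_ring_eval_single trace_monomial_def vec_eq_iff)
  then show ?thesis by blast
qed

lemma trace_polynomials_subset_range_symb_eval: "trace_polynomials \<subseteq> range symb_eval"
proof
  fix H :: "('a, 'b) endo_tuple \<Rightarrow> ('a, 'c) tensor_endo"
  assume "H \<in> trace_polynomials"
  then obtain m :: nat and c t where H: "\<And>x. H x = (\<Sum>a<m. c a *m trace_monomial (t a) x)"
    by (auto simp: trace_polynomials_def)
  have "\<forall>a. \<exists>s. \<forall>x :: ('a, 'b) endo_tuple. symb_eval s x = c a *m trace_monomial (t a) x"
    using trace_monomial_symb_eval by blast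
  then obtain s where "\<And>a x :: ('a, 'b) endo_tuple. symb_eval (s a) x = c a *m trace_monomial (t a) x"
    unfolding choice_iff by blast
  then have "H = symb_eval (\<Sum>a<m. s a)"
    by (simp add: fun_eq_iff H symb_eval_sum)
  then show "H \<in> range symb_eval" by blast
qed

theorem theorem2p10:
  shows "(\<forall>H :: ('d::finite, 'k::finite) endo_tuple \<Rightarrow> ('d, 'n::finite) tensor_endo.
            polynomial_map H \<longrightarrow> equivariant H \<longrightarrow>
            (\<exists>(m::nat) (c :: nat \<Rightarrow> rat) (N :: nat \<Rightarrow> 'k list list)
               (\<sigma> :: nat \<Rightarrow> 'n perm) (M :: nat \<Rightarrow> 'n \<Rightarrow> 'k list).
               \<forall>x. H x = (\<Sum>a<m. c a *m
                     ((\<Prod>w\<leftarrow>N a. trace (word_eval x w)) *m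
                       (perm_endo (inverse (\<sigma> a)) ** tensor_endo (\<lambda>i. word_eval x (M a i)))))))
       \<and> range (symb_eval :: ('k, 'n) symbolic \<Rightarrow>
                  ('d, 'k) endo_tuple \<Rightarrow> ('d, 'n) tensor_endo) = equivariant_maps"
proof (intro conjI allI impI)
  fix H :: "('d, 'k) endo_tuple \<Rightarrow> ('d, 'n) tensor_endo"
  assume "polynomial_map H" "equivariant H"
  then have "H \<in> trace_polynomials"
    by (rule equivariant_polynomial_in_trace_polynomials)
  then obtain m :: nat and c t where H: "\<And>x. H x = (\<Sum>a<m. c a *m trace_monomial (t a) x)"
    by (auto simp: trace_polynomials_def)
  show "\<exists>(m::nat) c N \<sigma> M. \<forall>x. H x = (\<Sum>a<m. c a *m
      ((\<Prod>w\<leftarrow>N a. trace (word_eval x w)) *m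
        (perm_endo (inverse (\<sigma> a)) ** tensor_endo (\<lambda>i. word_eval x (M a i)))))"
    by (intro exI[of _ m] exI[of _ c] exI[of _ "\<lambda>a. fst (t a)"] exI[of _ "\<lambda>a. fst (snd (t a))"]
        exI[of _ "\<lambda>a. snd (snd (t a))"])
      (simp add: H trace_monomial_def case_prod_unfold)
next
  show "range (symb_eval :: ('k, 'n) symbolic \<Rightarrow>
      ('d, 'k) endo_tuple \<Rightarrow> ('d, 'n) tensor_endo) = equivariant_maps"
    using symb_eval_in_equivariant_maps equivariant_polynomial_in_trace_polynomials
      trace_polynomials_subset_range_symb_eval
    by (fastforce simp: equivariant_maps_def)
qed

end
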